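(* Let $f,t\in L^2(\mathbb{R}^3)$, $x\in\mathbb{R}^3$, and let $n\in 2\mathbb{N}$ be an even positive integer. Let $S:L^2(\mathbb{R}^3)\to L^2(\mathbb{R}^3)$ be a symmetric semidefinite positive (SSP) operator that commutes with rotations, with $\langle\mathbf{1},\mathbf{1}\rangle_S>0$, and let $t$ be normalized by $\langle t,\mathbf{1}\rangle_S=0$ and $\|t\|_S=1$. If there is a match between $f$ and $t_R$ at $x$, then the function $$\varphi(Q)=C_n(x)\cdot Q^{\odot n},$$ defined on rotations of $\mathbb{R}^3$ parametrized by unit quaternions $Q$, attains its global maximum at $Q=R$.
   Context: All functions are real-valued, and $\langle f,g\rangle=\int_{\mathbb{R}^3}f(z)g(z)\,dz$. A linear operator $S:L^2(\mathbb{R}^3)\to L^2(\mathbb{R}^3)$ is SSP (symmetric semidefinite positive) if $\langle f,S(g)\rangle=\langle S(f),g\rangle$ and $\langle f,S(f)\rangle\ge 0$ for all $f,g$. One sets $\langle f,g\rangle_S=\langle f,S(g)\rangle$ and $\|f\|_S=\sqrt{\langle f,f\rangle_S}$. For $x\in\mathbb{R}^3$, $\tau_x(f)(z)=f(z+x)$. For $R\in SO(3)$, $O_R(f)(z)=f(Rz)$ and $t_R=O_{R^{-1}}(t)$, i.e. $t_R(z)=t(R^{-1}z)$. "$S$ commutes with rotations" means $S\circ O_R=O_R\circ S$ for all $R\in SO(3)$. $\mathbf{1}$ denotes the constant function $1$. Convention: there is a bounded neighbourhood $\mathbf{D}$ of $\mathbf{0}$ such that $S(g)=0$ whenever $g$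 vanishes a.e. on $\mathbf{D}$; whenever $\mathbf{1}$ appears in $\langle\cdot,\cdot\rangle_S$, $\|\cdot\|_S$ or as an argument of $S$, it stands for the indicator function of any bounded measurable set containing $\mathbf{D}$ (the choice does not matter). Put $$P_S(f)=f-\frac{\langle f,\mathbf{1}\rangle_S}{\langle\mathbf{1},\mathbf{1}\rangle_S}\mathbf{1}.$$ It is assumed that $\|P_S(\tau_x(f))\|_S>0$; set $w(x)=1/\|P_S(\tau_x(f))\|_S$ and $$c(x,R)=w(x)\langle\tau_x(f),t_R\rangle_S=\frac{\langle P_S(\tau_x(f)),P_S(t_R)\rangle_S}{\|P_S(\tau_x(f))\|_S\,\|P_S(t_R)\|_S}.$$ There is a match between $f$ and $t_R$ at $x$ if $c(x,R)=1$. Rotations of $\mathbb{R}^3$ are parametrized by unit quaternions in the usual way (the unit quaternion $q$ represents the rotation $v\mapsto qvq^{-1}$ of the purely imaginary quaternions $\cong\mathbb{R}^3$); a unit quaternion $a+b\mathbf{i}+c\mathbf{j}+d\mathbf{k}$ is identified with $(a,b,c,d)\in S^3\subset\mathbb{R}^4$. Integration $\int_{SO(3)}\cdot\,dR$ is carried out over unit quaternions in $S^3$ with respect to the rotation-invariant surface measure. The same letter $R$ denotes the rotation and a unit quaternion representing it ($n$ even makes the sign ambiguity immaterial). For $v\in\mathbb{R}^4$, $v^{\odot n}=(v_{i_1}\cdots v_{i_n})_{1\le i_1,\dots,i_n\le 4}$ is its $n$-th tensor power, and for order-$n$ tensors $A,B$, $A\cdot B=\sum_{i_1,\dots,i_n=1}^4A_{i_1,\dots,i_n}B_{i_1,\dots,i_n}$.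 The symmetric tensor $C_n(x)$ of order $n$ and dimension $4$ is $$C_n(x)=\int_{SO(3)}R^{\odot n}\,c(x,R)\,dR .$$ *)

theory Defs
  imports "HOL-Analysis.Analysis"
begin

text \<open>Elements of \<open>L\<^sup>2(\<real>\<^sup>3)\<close> are represented by real functions; two representatives of the
  same element are identified explicitly by equality almost everywhere.\<close>

definition L2_space :: "(real^3 \<Rightarrow> real) set" where
  "L2_space = {f \<in> borel_measurable lebesgue. integrable lebesgue (\<lambda>z. (f z)\<^sup>2)}"

definition ae_eq :: "(real^3 \<Rightarrow> real) \<Rightarrow> (real^3 \<Rightarrow> real) \<Rightarrow> bool" where
  "ae_eq f g \<longleftrightarrow> (AE z in lebesgue. f z = g z)"

definition L2_inner :: "(real^3 \<Rightarrow> real) \<Rightarrow> (real^3 \<Rightarrow> real) \<Rightarrow> real" where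
  "L2_inner f g = (\<integral>z. f z * g z \<partial>lebesgue)"

text \<open>The second conjunct says that \<open>S\<close> is well defined on almost-everywhere classes.\<close>

definition L2_linear :: "((real^3 \<Rightarrow> real) \<Rightarrow> (real^3 \<Rightarrow> real)) \<Rightarrow> bool" where
  "L2_linear S \<longleftrightarrow>
     (\<forall>f\<in>L2_space. S f \<in> L2_space) \<and>
     (\<forall>f\<in>L2_space. \<forall>g\<in>L2_space. ae_eq f g \<longrightarrow> ae_eq (S f) (S g)) \<and>
     (\<forall>f\<in>L2_space. \<forall>g\<in>L2_space. ae_eq (S (\<lambda>z. f z + g z)) (\<lambda>z. S f z + S g z)) \<and>
     (\<forall>f\<in>L2_space. \<forall>a. ae_eq (S (\<lambda>z. a * f z)) (\<lambda>z. a * S f z))"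

definition SSP :: "((real^3 \<Rightarrow> real) \<Rightarrow> (real^3 \<Rightarrow> real)) \<Rightarrow> bool" where
  "SSP S \<longleftrightarrow> L2_linear S \<and>
     (\<forall>f\<in>L2_space. \<forall>g\<in>L2_space. L2_inner f (S g) = L2_inner (S f) g) \<and>
     (\<forall>f\<in>L2_space. L2_inner f (S f) \<ge> 0)"

definition inner_S ::
  "((real^3 \<Rightarrow> real) \<Rightarrow> (real^3 \<Rightarrow> real)) \<Rightarrow> (real^3 \<Rightarrow> real) \<Rightarrow> (real^3 \<Rightarrow> real) \<Rightarrow> real" where
  "inner_S S f g = L2_inner f (S g)"

definition norm_S ::
  "((real^3 \<Rightarrow> real) \<Rightarrow> (real^3 \<Rightarrow> real)) \<Rightarrow> (real^3 \<Rightarrow> real) \<Rightarrow> real" where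
  "norm_S S f = sqrt (inner_S S f f)"

definition translate :: "real^3 \<Rightarrow> (real^3 \<Rightarrow> real) \<Rightarrow> (real^3 \<Rightarrow> real)" where
  "translate x f = (\<lambda>z. f (z + x))"

definition rotate_fun :: "real^3^3 \<Rightarrow> (real^3 \<Rightarrow> real) \<Rightarrow> (real^3 \<Rightarrow> real)" where
  "rotate_fun R f = (\<lambda>z. f (R *v z))"

definition rotated_template :: "(real^3 \<Rightarrow> real) \<Rightarrow> real^3^3 \<Rightarrow> (real^3 \<Rightarrow> real)" where
  "rotated_template t R = rotate_fun (matrix_inv R) t"

definition commutes_with_rotations :: "((real^3 \<Rightarrow> real) \<Rightarrow> (real^3 \<Rightarrow> real)) \<Rightarrow> bool" where
  "commutes_with_rotations S \<longleftrightarrow>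
     (\<forall>R. rotation_matrix R \<longrightarrow>
       (\<forall>f\<in>L2_space. ae_eq (S (rotate_fun R f)) (rotate_fun R (S f))))"

definition localized_on :: "((real^3 \<Rightarrow> real) \<Rightarrow> (real^3 \<Rightarrow> real)) \<Rightarrow> (real^3) set \<Rightarrow> bool" where
  "localized_on S D \<longleftrightarrow>
     (\<forall>g\<in>L2_space. (AE z in lebesgue. z \<in> D \<longrightarrow> g z = 0) \<longrightarrow> ae_eq (S g) (\<lambda>z. 0))"

text \<open>The constant function 1 is not in \<open>L\<^sup>2(\<real>\<^sup>3)\<close>. In everything that follows it is replaced by
  the indicator function of a set \<open>E\<close>, which is meant to be bounded, measurable and to contain a set
  on which \<open>S\<close> is localized.\<close>

definition P_S ::
  "((real^3 \<Rightarrow> real) \<Rightarrow> (real^3 \<Rightarrow> real)) \<Rightarrow> (real^3) set \<Rightarrow> (real^3 \<Rightarrow> real) \<Rightarrow> (real^3 \<Rightarrow> real)"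
where
  "P_S S E f = (\<lambda>z. f z -
     inner_S S f (indicator E) / inner_S S (indicator E) (indicator E) * indicator E z)"

definition weight ::
  "((real^3 \<Rightarrow> real) \<Rightarrow> (real^3 \<Rightarrow> real)) \<Rightarrow> (real^3) set \<Rightarrow> (real^3 \<Rightarrow> real) \<Rightarrow> real^3 \<Rightarrow> real"
where
  "weight S E f x = 1 / norm_S S (P_S S E (translate x f))"

definition correlation ::
  "((real^3 \<Rightarrow> real) \<Rightarrow> (real^3 \<Rightarrow> real)) \<Rightarrow> (real^3) set \<Rightarrow> (real^3 \<Rightarrow> real) \<Rightarrow> (real^3 \<Rightarrow> real) \<Rightarrow>
    real^3 \<Rightarrow> real^3^3 \<Rightarrow> real"
where
  "correlation S E f t x R =
     weight S E f x * inner_S S (translate x f) (rotated_template t R)"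

definition is_match ::
  "((real^3 \<Rightarrow> real) \<Rightarrow> (real^3 \<Rightarrow> real)) \<Rightarrow> (real^3) set \<Rightarrow> (real^3 \<Rightarrow> real) \<Rightarrow> (real^3 \<Rightarrow> real) \<Rightarrow>
    real^3 \<Rightarrow> real^3^3 \<Rightarrow> bool"
where
  "is_match S E f t x R \<longleftrightarrow> correlation S E f t x R = 1"

text \<open>The quaternion \<open>a + b i + c j + d k\<close> is the vector \<open>(a, b, c, d)\<close>.\<close>

definition quat_mult :: "real^4 \<Rightarrow> real^4 \<Rightarrow> real^4" where
  "quat_mult p q = vector
    [p$1 * q$1 - p$2 * q$2 - p$3 * q$3 - p$4 * q$4,
     p$1 * q$2 + p$2 * q$1 + p$3 * q$4 - p$4 * q$3,
     p$1 * q$3 - p$2 * q$4 + p$3 * q$1 + p$4 * q$2,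
     p$1 * q$4 + p$2 * q$3 - p$3 * q$2 + p$4 * q$1]"

definition quat_inverse :: "real^4 \<Rightarrow> real^4" where
  "quat_inverse q = inverse ((norm q)\<^sup>2) *\<^sub>R vector [q$1, - q$2, - q$3, - q$4]"

definition quat_of_vec :: "real^3 \<Rightarrow> real^4" where
  "quat_of_vec v = vector [0, v$1, v$2, v$3]"

definition vec_of_quat :: "real^4 \<Rightarrow> real^3" where
  "vec_of_quat q = vector [q$2, q$3, q$4]"

definition quat_rotation :: "real^4 \<Rightarrow> real^3^3" where
  "quat_rotation q =
     matrix (\<lambda>v. vec_of_quat (quat_mult (quat_mult q (quat_of_vec v)) (quat_inverse q)))"

lemma vector_4:
  "(vector [w, x, y, z] :: 'a::zero^4) $ 1 = w"
  "(vector [w, x, y, z] :: 'a::zero^4) $ 2 = x"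
  "(vector [w, x, y, z] :: 'a::zero^4) $ 3 = y"
  "(vector [w, x, y, z] :: 'a::zero^4) $ 4 = z"
  unfolding vector_def by simp_all

lemma quat_mult_inverse:
  assumes "q \<noteq> 0"
  shows "quat_mult q (quat_inverse q) = vector [1, 0, 0, 0]"
proof -
  have n: "(norm q)\<^sup>2 = q$1 * q$1 + q$2 * q$2 + q$3 * q$3 + q$4 * q$4"
    by (simp add: power2_norm_eq_inner inner_vec_def sum_4)
  have "(norm q)\<^sup>2 \<noteq> 0" using assms by simp
  then show ?thesis
    by (simp add: quat_mult_def quat_inverse_def vec_eq_iff forall_4 vector_4 field_simps)
       (simp add: n)
qed

lemma quat_conjugation_imaginary:
  "quat_mult (quat_mult q (quat_of_vec v)) (quat_inverse q) $ 1 = 0"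
  by (simp add: quat_mult_def quat_inverse_def quat_of_vec_def vector_4 algebra_simps)

lemma rotation_matrix_quat_rotation:
  assumes "norm q = 1"
  shows "rotation_matrix (quat_rotation q)"
proof -
  have n: "q$1 * q$1 + q$2 * q$2 + q$3 * q$3 + q$4 * q$4 = 1"
    using assms by (simp add: norm_eq_1 inner_vec_def sum_4)
  have e: "quat_rotation q = vector
    [vector [q$1*q$1 + q$2*q$2 - q$3*q$3 - q$4*q$4, 2*(q$2*q$3 - q$1*q$4), 2*(q$2*q$4 + q$1*q$3)],
     vector [2*(q$2*q$3 + q$1*q$4), q$1*q$1 - q$2*q$2 + q$3*q$3 - q$4*q$4, 2*(q$3*q$4 - q$1*q$2)],
     vector [2*(q$2*q$4 - q$1*q$3), 2*(q$3*q$4 + q$1*q$2), q$1*q$1 - q$2*q$2 - q$3*q$3 + q$4*q$4]]"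
    using assms
    by (simp add: quat_rotation_def matrix_def vec_eq_iff forall_3 quat_mult_def quat_inverse_def
        quat_of_vec_def vec_of_quat_def vector_4 axis_def algebra_simps)
  have n2: "(q$1 * q$1 + q$2 * q$2 + q$3 * q$3 + q$4 * q$4) ^ 2 = 1"
    "(q$1 * q$1 + q$2 * q$2 + q$3 * q$3 + q$4 * q$4) ^ 3 = 1"
    by (simp_all add: n)
  have o: "orthogonal_matrix (quat_rotation q)"
    unfolding orthogonal_matrix e
    using n2(1)
    by (simp add: matrix_matrix_mult_def transpose_def mat_def vec_eq_iff forall_3 sum_3
        power2_eq_square algebra_simps)
  have "det (quat_rotation q) = 1"
    unfolding e det_3 using n2(2) by (simp add: power3_eq_cube algebra_simps)
  with o show ?thesis by (simp add: rotation_matrix_def)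
qed

text \<open>Surface measure on the unit sphere of \<open>\<real>\<^sup>4\<close>, given as in polar coordinates by 4 times the volume
  of the cone over a subset of the sphere (see \<open>emeasure_sphere_measure\<close>).\<close>

definition sphere_measure :: "(real^4) measure" where
  "sphere_measure = scale_measure 4
     (distr (restrict_space lborel (cball 0 1 - {0})) (restrict_space borel (sphere 0 1)) sgn)"


lemma emeasure_sphere_measure:
  assumes A: "A \<in> sets (restrict_space borel (sphere 0 1))"
  shows "emeasure sphere_measure A = 4 * emeasure lborel {r *\<^sub>R a | r a. 0 < r \<and> r \<le> 1 \<and> a \<in> A}"
proof -
  let ?B = "cball 0 1 - {0} :: (real^4) set"
  let ?M = "restrict_space lborel ?B"
  have AS: "A \<subseteq> sphere 0 1"
    using sets.sets_into_space[OF A] by (simp add: space_restrict_space)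
  have sgn: "(sgn :: real^4 \<Rightarrow> _) \<in> borel_measurable borel"
    unfolding sgn_div_norm by measurable
  have m: "sgn \<in> measurable ?M (restrict_space borel (sphere 0 1))"
    by (intro measurable_restrict_space2 measurable_restrict_space1)
       (use sgn in \<open>auto simp: space_restrict_space norm_sgn\<close>)
  have eq: "sgn -` A \<inter> space ?M = {r *\<^sub>R a | r a. 0 < r \<and> r \<le> 1 \<and> a \<in> A}" (is "?L = ?R")
  proof
    show "?L \<subseteq> ?R"
    proof
      fix y assume y: "y \<in> ?L"
      then have "y = norm y *\<^sub>R sgn y" "0 < norm y" "norm y \<le> 1" "sgn y \<in> A"
        by (auto simp: space_restrict_space sgn_div_norm)
      then show "y \<in> ?R" by blast
    qed
    show "?R \<subseteq> ?L"
    proof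
      fix y assume "y \<in> ?R"
      then obtain r a where y: "y = r *\<^sub>R a" "0 < r" "r \<le> 1" "a \<in> A" by auto
      moreover have "norm a = 1" using y AS by auto
      ultimately show "y \<in> ?L"
        by (auto simp: space_restrict_space sgn_div_norm)
    qed
  qed
  have "emeasure sphere_measure A = 4 * emeasure ?M (sgn -` A \<inter> space ?M)"
    unfolding sphere_measure_def using A by (simp add: emeasure_distr[OF m])
  also have "emeasure ?M (sgn -` A \<inter> space ?M) = emeasure lborel (sgn -` A \<inter> space ?M)"
    by (rule emeasure_restrict_space) (auto simp: space_restrict_space)
  finally show ?thesis by (simp only: eq)
qed

text \<open>An order-\<open>n\<close> tensor of dimension 4 is a function of the multi-indices
  \<open>(i\<^sub>0, \<dots>, i\<^bsub>n-1\<^esub>)\<close>, which are the elements of \<open>{..<n} \<rightarrow>\<^sub>E UNIV\<close>.\<close>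

definition tensor_power :: "nat \<Rightarrow> real^4 \<Rightarrow> (nat \<Rightarrow> 4) \<Rightarrow> real" where
  "tensor_power n v i = (\<Prod>k<n. v $ i k)"

definition tensor_dot :: "nat \<Rightarrow> ((nat \<Rightarrow> 4) \<Rightarrow> real) \<Rightarrow> ((nat \<Rightarrow> 4) \<Rightarrow> real) \<Rightarrow> real" where
  "tensor_dot n A B = (\<Sum>i\<in>{..<n} \<rightarrow>\<^sub>E UNIV. A i * B i)"

definition tensor_field ::
  "((real^3 \<Rightarrow> real) \<Rightarrow> (real^3 \<Rightarrow> real)) \<Rightarrow> (real^3) set \<Rightarrow> (real^3 \<Rightarrow> real) \<Rightarrow> (real^3 \<Rightarrow> real) \<Rightarrow>
    nat \<Rightarrow> real^3 \<Rightarrow> (nat \<Rightarrow> 4) \<Rightarrow> real"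
where
  "tensor_field S E f t n x i =
     (\<integral>q. tensor_power n q i * correlation S E f t x (quat_rotation q) \<partial>sphere_measure)"

end

theory Submission
  imports Defs
begin

text \<open>Write \<open>t\<^sub>q\<close> for the template rotated by the unit quaternion \<open>q\<close> and
  \<open>k(a, b) = \<langle>t\<^sub>a, t\<^sub>b\<rangle>\<^sub>S\<close>. A match is the equality case of the Cauchy-Schwarz inequality, so
  \<open>c(x, q) = k(R, q)\<close> for all \<open>q\<close> and \<open>\<phi>(Q) = \<integral> (q \<bullet> Q)\<^sup>n k(R, q) dq\<close>. The kernel \<open>k\<close> is symmetric,
  invariant under left multiplication and positive semidefinite. With \<open>P = R\<^sup>-\<^sup>1 Q\<close>, positivity applied
  to the components of the tensors \<open>a\<^sup>n - (a P)\<^sup>n\<close> gives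
  \<open>0 \<le> \<integral>\<integral> k(a, b) ((a \<bullet> b)\<^sup>n - (a \<bullet> b P)\<^sup>n - (a P \<bullet> b)\<^sup>n + (a P \<bullet> b P)\<^sup>n) da db\<close>.
  By left invariance the inner integral does not depend on \<open>a\<close>, and at \<open>a = R\<close> it equals
  \<open>2 (\<phi>(R) - \<phi>(Q))\<close>.\<close>

section \<open>Square-integrable functions and measure-preserving maps\<close>

lemma measurable_orthogonal_transformation:
  fixes T :: "'a::euclidean_space \<Rightarrow> 'a"
  assumes "orthogonal_transformation T"
  shows "T \<in> borel_measurable borel"
  using assms by (intro borel_measurable_continuous_onI linear_continuous_on
    linear_conv_bounded_linear[THEN iffD1] orthogonal_transformation_linear)

text \<open>Lebesgue measure is determined by its values on boxes. The preimage of a box under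
  \<open>T\<close> is its image under the orthogonal map \<open>inv T\<close>, and orthogonal images
  preserve measure.\<close>

lemma lborel_distr_orthogonal:
  fixes T :: "real^'n::{finite,wellorder} \<Rightarrow> real^'n::_"
  assumes T: "orthogonal_transformation T"
  shows "distr lborel borel T = lborel"
proof (rule lborel_eqI[symmetric])
  note [measurable] = measurable_orthogonal_transformation[OF T]
  have inv: "orthogonal_transformation (inv T)"
    using T by (rule orthogonal_transformation_inv)
  fix l u :: "real^'n::{finite,wellorder}" assume le: "\<And>b. b \<in> Basis \<Longrightarrow> l \<bullet> b \<le> u \<bullet> b"
  have pre: "T -` box l u = inv T ` box l u"
    using T by (simp add: bij_vimage_eq_inv_image orthogonal_transformation_bij)
  have m: "inv T ` box l u \<in> lmeasurable"
    by (rule measurable_orthogonal_image[OF inv]) simp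
  have "T -` box l u \<in> sets borel"
    using measurable_sets[of T borel borel "box l u"] by simp
  then have "emeasure (distr lborel borel T) (box l u) = emeasure lebesgue (inv T ` box l u)"
    by (simp add: emeasure_distr pre)
  also have "\<dots> = ennreal (measure lebesgue (inv T ` box l u))"
    using m by (simp add: emeasure_eq_measure2)
  also have "measure lebesgue (inv T ` box l u) = measure lebesgue (box l u)"
    by (rule measure_orthogonal_image[OF inv]) simp
  also have "\<dots> = (\<Prod>b\<in>Basis. (u - l) \<bullet> b)"
    using le by (simp add: measure_lborel_box_eq)
  finally show "emeasure (distr lborel borel T) (box l u) = (\<Prod>b\<in>Basis. (u - l) \<bullet> b)" .
qed simp

text \<open>Borel representatives are needed because a Lebesgue measurable function composed with a
  Borel map need not be measurable, and because Fubini's theorem is applied below to products with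
  \<open>lborel\<close>.\<close>

lemma L2_spaceE:
  assumes "f \<in> L2_space"
  obtains g where "g \<in> borel_measurable borel" "integrable lborel (\<lambda>z. (g z)\<^sup>2)"
    "AE z in lborel. f z = g z"
proof -
  have f: "f \<in> borel_measurable lebesgue" "integrable lebesgue (\<lambda>z. (f z)\<^sup>2)"
    using assms by (auto simp: L2_space_def)
  obtain g where g: "g \<in> borel_measurable lborel" "AE z in lborel. f z = g z"
    using completion_ex_borel_measurable_real[OF f(1)] by auto
  have gl: "g \<in> borel_measurable lebesgue" using g(1) by (rule measurable_completion)
  have "integrable lebesgue (\<lambda>z. (g z)\<^sup>2)"
    by (rule integrable_cong_AE_imp[OF f(2)]) (use g(2) gl in \<open>auto simp: AE_completion_iff\<close>)
  then have "integrable lborel (\<lambda>z. (g z)\<^sup>2)"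
    using g(1) by (subst (asm) integrable_completion) auto
  with g show ?thesis using that by simp
qed

lemma borel_measurable_lebesgue_AE:
  fixes f g :: "'a::euclidean_space \<Rightarrow> real"
  assumes "g \<in> borel_measurable borel" "AE z in lborel. f z = g z"
  shows "f \<in> borel_measurable lebesgue"
  by (rule borel_measurable_AE[of g])
     (use assms in \<open>auto simp: AE_completion_iff eq_commute intro!: measurable_completion\<close>)

lemma L2_spaceI:
  assumes g: "g \<in> borel_measurable borel" "integrable lborel (\<lambda>z. (g z)\<^sup>2)"
    and ae: "AE z in lborel. f z = g z"
  shows "f \<in> L2_space"
proof -
  have f: "f \<in> borel_measurable lebesgue"
    using borel_measurable_lebesgue_AE[OF g(1) ae] .
  have "integrable lebesgue (\<lambda>z. (g z)\<^sup>2)"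
    using g by (subst integrable_completion) auto
  then have "integrable lebesgue (\<lambda>z. (f z)\<^sup>2)"
    by (rule integrable_cong_AE_imp) (use ae f in \<open>auto simp: AE_completion_iff\<close>)
  with f show ?thesis by (simp add: L2_space_def)
qed

lemma L2_inner_eq_lborel:
  assumes "f \<in> L2_space" "g \<in> L2_space"
    and m: "f' \<in> borel_measurable borel" "g' \<in> borel_measurable borel"
    and ae: "AE z in lborel. f z = f' z" "AE z in lborel. g z = g' z"
  shows "L2_inner f g = (\<integral>z. f' z * g' z \<partial>lborel)"
proof -
  have [measurable]: "f \<in> borel_measurable lebesgue" "g \<in> borel_measurable lebesgue"
    using assms by (auto simp: L2_space_def)
  have [measurable]: "f' \<in> borel_measurable lebesgue" "g' \<in> borel_measurable lebesgue"
    using m by (auto intro!: measurable_completion)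
  have "L2_inner f g = (\<integral>z. f' z * g' z \<partial>lebesgue)"
    unfolding L2_inner_def
    by (rule integral_cong_AE) (use ae in \<open>auto simp: AE_completion_iff\<close>)
  also have "\<dots> = (\<integral>z. f' z * g' z \<partial>lborel)"
    using m by (intro integral_completion) auto
  finally show ?thesis .
qed

lemma L2_inner_commute: "L2_inner f g = L2_inner g f"
  by (simp add: L2_inner_def mult.commute)

lemma L2_inner_cong_AE:
  assumes "f \<in> L2_space" "g \<in> L2_space" "g' \<in> L2_space" "ae_eq g g'"
  shows "L2_inner f g = L2_inner f g'"
  using assms unfolding L2_inner_def ae_eq_def L2_space_def by (intro integral_cong_AE) auto

lemma abs_mult_le_sum_squares: "\<bar>x * y\<bar> \<le> x\<^sup>2 + y\<^sup>2" for x y :: real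
proof -
  have "0 \<le> \<bar>x * y\<bar>" by simp
  moreover have "2 * \<bar>x * y\<bar> \<le> x\<^sup>2 + y\<^sup>2"
    using sum_squares_bound[of "\<bar>x\<bar>" "\<bar>y\<bar>"] by (simp add: abs_mult)
  ultimately show ?thesis by linarith
qed

lemma integrable_mult_of_power2:
  fixes f g :: "'a \<Rightarrow> real"
  assumes [measurable]: "f \<in> borel_measurable M" "g \<in> borel_measurable M"
    and int: "integrable M (\<lambda>z. (f z)\<^sup>2)" "integrable M (\<lambda>z. (g z)\<^sup>2)"
  shows "integrable M (\<lambda>z. f z * g z)"
proof (rule Bochner_Integration.integrable_bound)
  show "integrable M (\<lambda>z. (f z)\<^sup>2 + (g z)\<^sup>2)" using int by simp
  show "AE z in M. norm (f z * g z) \<le> norm ((f z)\<^sup>2 + (g z)\<^sup>2)"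
    using abs_mult_le_sum_squares by simp
qed simp

lemma integrable_mult_L2:
  assumes "f \<in> L2_space" "g \<in> L2_space"
  shows "integrable lebesgue (\<lambda>z. f z * g z)"
  using assms by (intro integrable_mult_of_power2) (auto simp: L2_space_def)

lemma L2_space_add:
  assumes "f \<in> L2_space" "g \<in> L2_space"
  shows "(\<lambda>z. f z + g z) \<in> L2_space"
proof -
  have "integrable lebesgue (\<lambda>z. (f z)\<^sup>2 + (g z)\<^sup>2 + 2 * (f z * g z))"
    using assms integrable_mult_L2[OF assms] by (simp add: L2_space_def)
  then have "integrable lebesgue (\<lambda>z. (f z + g z)\<^sup>2)"
    by (simp add: power2_sum algebra_simps)
  then show ?thesis using assms by (auto simp: L2_space_def)
qed

lemma L2_space_scale:
  assumes "f \<in> L2_space" shows "(\<lambda>z. c * f z) \<in> L2_space"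
  using assms by (auto simp: L2_space_def power_mult_distrib)

lemma L2_inner_add_right:
  assumes "f \<in> L2_space" "g \<in> L2_space" "h \<in> L2_space"
  shows "L2_inner f (\<lambda>z. g z + h z) = L2_inner f g + L2_inner f h"
  using integrable_mult_L2[OF assms(1,2)] integrable_mult_L2[OF assms(1,3)]
  by (simp add: L2_inner_def distrib_left)

lemma L2_inner_scale_right: "L2_inner f (\<lambda>z. c * g z) = c * L2_inner f g"
  unfolding L2_inner_def integral_mult_right_zero[symmetric] by (simp add: mult.left_commute)

lemma L2_space_indicator:
  assumes "bounded E" "E \<in> sets lebesgue"
  shows "indicator E \<in> L2_space"
proof -
  have "E \<in> lmeasurable" using assms by (rule bounded_set_imp_lmeasurable)
  then have "integrable lebesgue (indicator E :: _ \<Rightarrow> real)"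
    by (auto simp: fmeasurable_def)
  moreover have "(\<lambda>z. (indicator E z)\<^sup>2) = (indicator E :: _ \<Rightarrow> real)"
    by (auto simp: indicator_def)
  ultimately show ?thesis using assms by (simp add: L2_space_def)
qed

section \<open>Composition with measure-preserving maps\<close>

lemma AE_lborel_distr:
  assumes "T \<in> borel_measurable borel" "distr lborel borel T = lborel" "AE z in lborel. P z"
  shows "AE z in lborel. P (T z)"
proof -
  have "AE z in distr lborel borel T. P z" unfolding assms(2) by (rule assms(3))
  then show ?thesis by (rule AE_distrD[rotated]) (use assms(1) in simp)
qed

text \<open>The composition is carried out on a Borel representative. The exceptional null set pulls
  back to a null set because \<open>T\<close> preserves the measure.\<close>

lemma L2_space_distr:
  assumes T[measurable]: "T \<in> borel_measurable borel" and dT: "distr lborel borel T = lborel"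
    and f: "f \<in> L2_space"
  shows "(\<lambda>z. f (T z)) \<in> L2_space"
proof -
  obtain g where g[measurable]: "g \<in> borel_measurable borel" "integrable lborel (\<lambda>z. (g z)\<^sup>2)"
    "AE z in lborel. f z = g z" using f by (rule L2_spaceE)
  have "integrable (distr lborel borel T) (\<lambda>z. (g z)\<^sup>2)" using g dT by simp
  then have "integrable lborel (\<lambda>z. (g (T z))\<^sup>2)"
    by (subst (asm) integrable_distr_eq) auto
  moreover have "AE z in lborel. f (T z) = g (T z)"
    by (rule AE_lborel_distr[OF T dT g(3)])
  ultimately show ?thesis by (intro L2_spaceI[of "\<lambda>z. g (T z)"]) auto
qed

lemma integral_lborel_distr:
  fixes h :: "'a::euclidean_space \<Rightarrow> real"
  assumes [measurable]: "T \<in> borel_measurable borel" "h \<in> borel_measurable borel"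
    and dT: "distr lborel borel T = lborel"
  shows "(\<integral>z. h (T z) \<partial>lborel) = (\<integral>z. h z \<partial>lborel)"
proof -
  have "(\<integral>z. h z \<partial>lborel) = (\<integral>z. h z \<partial>distr lborel borel T)" by (simp add: dT)
  also have "\<dots> = (\<integral>z. h (T z) \<partial>lborel)" by (rule integral_distr) auto
  finally show ?thesis ..
qed

lemma L2_inner_distr:
  assumes T[measurable]: "T \<in> borel_measurable borel" and dT: "distr lborel borel T = lborel"
    and f: "f \<in> L2_space" and g: "g \<in> L2_space"
  shows "L2_inner (\<lambda>z. f (T z)) (\<lambda>z. g (T z)) = L2_inner f g"
proof -
  obtain f' where f'[measurable]: "f' \<in> borel_measurable borel" "integrable lborel (\<lambda>z. (f' z)\<^sup>2)"
    "AE z in lborel. f z = f' z" using f by (rule L2_spaceE)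
  obtain g' where g'[measurable]: "g' \<in> borel_measurable borel" "integrable lborel (\<lambda>z. (g' z)\<^sup>2)"
    "AE z in lborel. g z = g' z" using g by (rule L2_spaceE)
  have "L2_inner (\<lambda>z. f (T z)) (\<lambda>z. g (T z)) = (\<integral>z. f' (T z) * g' (T z) \<partial>lborel)"
    by (rule L2_inner_eq_lborel)
       (use f g T dT AE_lborel_distr[OF T dT f'(3)] AE_lborel_distr[OF T dT g'(3)]
         in \<open>auto intro!: L2_space_distr\<close>)
  also have "\<dots> = (\<integral>z. f' z * g' z \<partial>lborel)"
    by (rule integral_lborel_distr[where h="\<lambda>z. f' z * g' z"]) (use dT in auto)
  also have "\<dots> = L2_inner f g"
    by (rule L2_inner_eq_lborel[symmetric]) (use f g f' g' in auto)
  finally show ?thesis .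
qed

section \<open>Unit quaternions\<close>

text \<open>On unit quaternions this is the inverse. Being linear, it turns the identities below
  into polynomial ones.\<close>

definition quat_cnj :: "real^4 \<Rightarrow> real^4" where
  "quat_cnj q = vector [q$1, - q$2, - q$3, - q$4]"

lemma quat_inverse_unit: "norm q = 1 \<Longrightarrow> quat_inverse q = quat_cnj q"
  by (simp add: quat_inverse_def quat_cnj_def)

lemma quat_mult_assoc: "quat_mult (quat_mult p q) r = quat_mult p (quat_mult q r)"
  by (simp add: quat_mult_def vec_eq_iff forall_4 vector_4 algebra_simps)

lemma quat_cnj_mult: "quat_cnj (quat_mult p q) = quat_mult (quat_cnj q) (quat_cnj p)"
  by (simp add: quat_cnj_def quat_mult_def vec_eq_iff forall_4 vector_4 algebra_simps)

lemma quat_cnj_cnj [simp]: "quat_cnj (quat_cnj q) = q"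
  by (simp add: quat_cnj_def vec_eq_iff forall_4 vector_4)

lemma inner_real4: "p \<bullet> q = p$1 * q$1 + p$2 * q$2 + p$3 * q$3 + p$4 * (q$4 :: real)"
  for p q :: "real^4"
  by (simp add: inner_vec_def sum_4)

text \<open>Polarized form of the multiplicativity of the quaternion norm; multiplication by a unit
  quaternion is therefore orthogonal on both sides.\<close>

lemma inner_quat_mult_left: "quat_mult g p \<bullet> quat_mult g q = (g \<bullet> g) * (p \<bullet> q)"
  by (simp add: inner_real4 quat_mult_def vector_4 algebra_simps)

lemma inner_quat_mult_right: "quat_mult p g \<bullet> quat_mult q g = (g \<bullet> g) * (p \<bullet> q)"
  by (simp add: inner_real4 quat_mult_def vector_4 algebra_simps)

lemma inner_quat_cnj: "quat_cnj p \<bullet> quat_cnj q = p \<bullet> q"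
  by (simp add: inner_real4 quat_cnj_def vector_4)

lemma linear_quat_mult_left: "linear (quat_mult g)"
  by (rule linearI) (simp_all add: quat_mult_def vec_eq_iff forall_4 vector_4 algebra_simps)

lemma linear_quat_mult_right: "linear (\<lambda>p. quat_mult p g)"
  by (rule linearI) (simp_all add: quat_mult_def vec_eq_iff forall_4 vector_4 algebra_simps)

lemma linear_quat_cnj: "linear quat_cnj"
  by (rule linearI) (simp_all add: quat_cnj_def vec_eq_iff forall_4 vector_4)

lemma orthogonal_quat_mult_left: "norm g = 1 \<Longrightarrow> orthogonal_transformation (quat_mult g)"
  by (simp add: orthogonal_transformation_def linear_quat_mult_left inner_quat_mult_left norm_eq_1)

lemma orthogonal_quat_mult_right: "norm g = 1 \<Longrightarrow> orthogonal_transformation (\<lambda>p. quat_mult p g)"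
  by (simp add: orthogonal_transformation_def linear_quat_mult_right inner_quat_mult_right norm_eq_1)

lemma orthogonal_quat_cnj: "orthogonal_transformation quat_cnj"
  by (simp add: orthogonal_transformation_def linear_quat_cnj inner_quat_cnj)

lemma norm_quat_mult: "norm p = 1 \<Longrightarrow> norm q = 1 \<Longrightarrow> norm (quat_mult p q) = 1"
  using orthogonal_transformation_norm[OF orthogonal_quat_mult_left] by simp

lemma norm_quat_cnj [simp]: "norm (quat_cnj q) = norm q"
  using orthogonal_transformation_norm[OF orthogonal_quat_cnj] by simp

lemma quat_mult_cnj_left: "norm q = 1 \<Longrightarrow> quat_mult (quat_cnj q) q = vector [1,0,0,0]"
  by (simp add: norm_eq_1 inner_real4 quat_cnj_def quat_mult_def vec_eq_iff forall_4 vector_4 algebra_simps)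

lemma quat_mult_cnj_right: "norm q = 1 \<Longrightarrow> quat_mult q (quat_cnj q) = vector [1,0,0,0]"
  using quat_mult_cnj_left[of "quat_cnj q"] by simp

lemma quat_mult_one_left [simp]: "quat_mult (vector [1,0,0,0]) q = q"
  by (simp add: quat_mult_def vec_eq_iff forall_4 vector_4)

lemma quat_mult_one_right [simp]: "quat_mult q (vector [1,0,0,0]) = q"
  by (simp add: quat_mult_def vec_eq_iff forall_4 vector_4)

lemma quat_rotation_apply:
  assumes "norm q = 1"
  shows "quat_rotation q *v v = vec_of_quat (quat_mult (quat_mult q (quat_of_vec v)) (quat_cnj q))"
proof -
  have "linear (\<lambda>v. vec_of_quat (quat_mult (quat_mult q (quat_of_vec v)) (quat_cnj q)))"
    by (rule linearI) (simp_all add: vec_of_quat_def quat_of_vec_def quat_mult_def vec_eq_iff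
       forall_3 vector_4 algebra_simps)
  then show ?thesis
    unfolding quat_rotation_def quat_inverse_unit[OF assms] by simp
qed

lemma quat_of_vec_of_quat: "q $ 1 = 0 \<Longrightarrow> quat_of_vec (vec_of_quat q) = q"
  by (simp add: vec_of_quat_def quat_of_vec_def vec_eq_iff forall_4 vector_4)

lemma quat_rotation_mult:
  assumes "norm p = 1" "norm q = 1"
  shows "quat_rotation (quat_mult p q) = quat_rotation p ** quat_rotation q"
proof (rule matrix_eq[THEN iffD2], rule allI)
  fix v
  \<comment> \<open>Conjugation by \<open>q\<close> yields a purely imaginary quaternion, so the
    passage through \<open>vec_of_quat\<close> between the two rotations loses nothing.\<close>
  have 0: "quat_mult (quat_mult q (quat_of_vec v)) (quat_cnj q) $ 1 = 0"
    using quat_conjugation_imaginary[of q v] quat_inverse_unit[OF assms(2)] by simp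
  show "quat_rotation (quat_mult p q) *v v = (quat_rotation p ** quat_rotation q) *v v"
    using assms by (simp add: quat_rotation_apply norm_quat_mult quat_of_vec_of_quat[OF 0]
        quat_cnj_mult flip: matrix_vector_mul_assoc) (simp add: quat_mult_assoc)
qed

lemma quat_rotation_one: "quat_rotation (vector [1,0,0,0]) = mat 1"
proof (rule matrix_eq[THEN iffD2], rule allI)
  fix v :: "real^3"
  have "norm (vector [1,0,0,0] :: real^4) = 1" by (simp add: norm_eq_1 inner_real4 vector_4)
  then show "quat_rotation (vector [1,0,0,0]) *v v = mat 1 *v v"
    by (simp add: quat_rotation_apply)
       (simp add: quat_mult_def quat_cnj_def vec_of_quat_def quat_of_vec_def vec_eq_iff forall_3 vector_4)
qed

lemma matrix_inv_quat_rotation: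
  assumes "norm q = 1"
  shows "matrix_inv (quat_rotation q) = quat_rotation (quat_cnj q)"
proof -
  have "quat_rotation q ** quat_rotation (quat_cnj q) = mat 1"
    "quat_rotation (quat_cnj q) ** quat_rotation q = mat 1"
    using assms by (simp_all add: quat_mult_cnj_left quat_mult_cnj_right quat_rotation_one
      flip: quat_rotation_mult)
  then show ?thesis
    \<comment> \<open>\<open>matrix_inv\<close> is a choice among two-sided inverses; associativity
      shows that there is only one.\<close>
    unfolding matrix_inv_def
    by (intro some_equality) (auto, metis matrix_mul_assoc matrix_mul_lid matrix_mul_rid)
qed

lemma orthogonal_quat_rotation:
  "norm q = 1 \<Longrightarrow> orthogonal_transformation ((*v) (quat_rotation q))"
  using rotation_matrix_quat_rotation[of q]
  by (simp add: rotation_matrix_def orthogonal_transformation_matrix)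

text \<open>Expanding the product of \<open>n\<close> equal sums over the coordinates gives one
  summand for each multi-index.\<close>

lemma tensor_dot_tensor_power: "tensor_dot n (tensor_power n p) (tensor_power n q) = (p \<bullet> q) ^ n"
proof -
  have "(p \<bullet> q) ^ n = (\<Prod>k<n. \<Sum>j\<in>UNIV. p $ j * q $ j)" by (simp add: inner_vec_def)
  also have "\<dots> = (\<Sum>i\<in>{..<n} \<rightarrow>\<^sub>E UNIV. \<Prod>k<n. p $ i k * q $ i k)"
    by (rule prod_sum_PiE) auto
  finally show ?thesis by (simp add: tensor_dot_def tensor_power_def prod.distrib)
qed

section \<open>The surface measure of the unit sphere\<close>

lemma space_sphere_measure [simp]: "space sphere_measure = sphere 0 1"
  by (simp add: sphere_measure_def space_restrict_space space_scale_measure)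

lemma sets_sphere_measure [measurable_cong]:
  "sets sphere_measure = sets (restrict_space borel (sphere 0 1))"
  by (simp add: sphere_measure_def)

lemma measurable_sphere_measure:
  "f \<in> borel_measurable borel \<Longrightarrow> f \<in> borel_measurable sphere_measure"
  by (subst measurable_cong_sets[OF sets_sphere_measure refl]) (rule measurable_restrict_space1)

text \<open>The cone over the whole sphere lies in the unit ball, which has finite volume.\<close>

lemma finite_measure_sphere: "finite_measure sphere_measure"
proof
  have "emeasure sphere_measure (sphere 0 1)
      = 4 * emeasure lborel {r *\<^sub>R a | r a :: real^4. 0 < r \<and> r \<le> 1 \<and> a \<in> sphere 0 1}"
    by (rule emeasure_sphere_measure) (simp add: sets_restrict_space_iff)
  also have "\<dots> \<le> 4 * emeasure lborel (cball (0::real^4) 1)"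
    by (intro mult_left_mono emeasure_mono) auto
  also have "\<dots> < \<infinity>"
    using emeasure_lborel_cball_finite[of "0::real^4" 1] by (simp add: ennreal_mult_less_top)
  finally show "emeasure sphere_measure (space sphere_measure) \<noteq> \<infinity>" by simp
qed

lemma measurable_sphere_orthogonal:
  assumes "orthogonal_transformation T"
  shows "T \<in> measurable sphere_measure sphere_measure"
proof -
  have "T \<in> measurable (restrict_space borel (sphere 0 1)) (restrict_space borel (sphere 0 1))"
    using assms measurable_orthogonal_transformation[OF assms]
    by (intro measurable_restrict_space3) (auto simp: orthogonal_transformation_norm)
  then show ?thesis
    by (subst measurable_cong_sets[OF sets_sphere_measure sets_sphere_measure])
qed

text \<open>An orthogonal map preserves norms and commutes with \<open>sgn\<close>, so the cone over
  a preimage is the preimage of the cone. Invariance is thus inherited from Lebesgue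
  measure.\<close>

lemma distr_sphere_orthogonal:
  assumes T: "orthogonal_transformation T"
  shows "distr sphere_measure sphere_measure T = sphere_measure"
proof (rule measure_eqI)
  fix A assume "A \<in> sets (distr sphere_measure sphere_measure T)"
  then have A: "A \<in> sets sphere_measure" by simp
  have mT: "T \<in> measurable sphere_measure sphere_measure"
    using T by (rule measurable_sphere_orthogonal)
  define cone where "cone B = {r *\<^sub>R a | r a :: real^4. 0 < r \<and> r \<le> 1 \<and> a \<in> B}" for B
  \<comment> \<open>Written as a preimage under \<open>sgn\<close>, the cone is visibly Borel and
    easy to compare with its preimage under \<open>T\<close>.\<close>
  have cone: "cone B = sgn -` B \<inter> (cball 0 1 - {0})" if "B \<subseteq> sphere 0 1" for B
  proof
    show "cone B \<subseteq> sgn -` B \<inter> (cball 0 1 - {0})"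
      using that by (auto simp: cone_def sgn_div_norm subset_iff)
    show "sgn -` B \<inter> (cball 0 1 - {0}) \<subseteq> cone B"
    proof
      fix y assume "y \<in> sgn -` B \<inter> (cball 0 1 - {0})"
      then have "y = norm y *\<^sub>R sgn y" "0 < norm y" "norm y \<le> 1" "sgn y \<in> B"
        by (auto simp: sgn_div_norm)
      then show "y \<in> cone B" unfolding cone_def by blast
    qed
  qed
  have B: "T -` A \<inter> sphere 0 1 \<in> sets sphere_measure"
    using measurable_sets[OF mT A] by simp
  have AS: "A \<subseteq> sphere 0 1" using sets.sets_into_space[OF A] by simp
  have "A \<in> sets borel"
    using A by (simp add: sets_sphere_measure sets_restrict_space_iff)
  moreover have "(sgn :: real^4 \<Rightarrow> _) \<in> borel_measurable borel"
    unfolding sgn_div_norm by measurable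
  ultimately have "sgn -` A \<inter> space borel \<in> sets borel" by (rule measurable_sets[rotated])
  then have cA: "cone A \<in> sets borel" unfolding cone[OF AS] by (auto intro!: sets.Int)
  have sgnT: "T (sgn y) = sgn (T y)" for y
    using T by (simp add: sgn_div_norm orthogonal_transformation_norm orthogonal_transformation_scaleR)
  have "T y = 0 \<longleftrightarrow> y = 0" for y
    using orthogonal_transformation_norm[OF T, of y] by (metis norm_eq_zero)
  then have eq: "cone (T -` A \<inter> sphere 0 1) = T -` cone A"
    unfolding cone[OF AS] cone[OF Int_lower2]
    using orthogonal_transformation_norm[OF T] by (auto simp: sgnT norm_sgn)
  have "emeasure (distr sphere_measure sphere_measure T) A
      = emeasure sphere_measure (T -` A \<inter> sphere 0 1)"
    using emeasure_distr[OF mT A] by simp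
  also have "\<dots> = 4 * emeasure lborel (T -` cone A)"
    using B emeasure_sphere_measure eq by (simp add: sets_sphere_measure cone_def)
  also have "emeasure lborel (T -` cone A) = emeasure (distr lborel borel T) (cone A)"
    using measurable_orthogonal_transformation[OF T] cA by (simp add: emeasure_distr)
  also have "\<dots> = emeasure lborel (cone A)" by (simp add: lborel_distr_orthogonal[OF T])
  also have "4 * \<dots> = emeasure sphere_measure A"
    using A emeasure_sphere_measure by (simp add: sets_sphere_measure cone_def)
  finally show "emeasure (distr sphere_measure sphere_measure T) A = emeasure sphere_measure A" .
qed simp

lemma integral_sphere_orthogonal:
  fixes h :: "real^4 \<Rightarrow> real"
  assumes T: "orthogonal_transformation T" and h: "h \<in> borel_measurable borel"
  shows "(\<integral>q. h (T q) \<partial>sphere_measure) = (\<integral>q. h q \<partial>sphere_measure)"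
proof -
  have "(\<integral>q. h q \<partial>sphere_measure) = (\<integral>q. h q \<partial>distr sphere_measure sphere_measure T)"
    by (simp add: distr_sphere_orthogonal[OF T])
  also have "\<dots> = (\<integral>q. h (T q) \<partial>sphere_measure)"
    by (rule integral_distr) (use T h in \<open>auto intro: measurable_sphere_orthogonal measurable_sphere_measure\<close>)
  finally show ?thesis ..
qed

lemma integrable_sphere_bounded:
  fixes h :: "real^4 \<Rightarrow> real"
  assumes "h \<in> borel_measurable borel" "\<And>q. norm q = 1 \<Longrightarrow> \<bar>h q\<bar> \<le> C"
  shows "integrable sphere_measure h"
  by (rule finite_measure.integrable_const_bound[OF finite_measure_sphere, of _ C])
     (use assms in \<open>auto intro: measurable_sphere_measure\<close>)

section \<open>The action of unit quaternions on space\<close>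

definition act :: "real^4 \<Rightarrow> real^3 \<Rightarrow> real^3" where
  "act q z = vec_of_quat (quat_mult (quat_mult (quat_cnj q) (quat_of_vec z)) q)"

lemma act_eq: "norm q = 1 \<Longrightarrow> act q z = quat_rotation (quat_cnj q) *v z"
  by (simp add: act_def quat_rotation_apply)

text \<open>The order is reversed because \<open>act q\<close> is the inverse rotation of
  \<open>q\<close> for unit \<open>q\<close>: it acts on the argument of a function. Left
  multiplication by \<open>p\<close> thus becomes a substitution performed first.\<close>

lemma act_mult: "act (quat_mult p q) z = act q (act p z)"
proof -
  have "quat_mult (quat_mult (quat_cnj p) (quat_of_vec z)) p $ 1 = 0"
    by (simp add: quat_mult_def quat_cnj_def quat_of_vec_def vector_4 algebra_simps)
  from quat_of_vec_of_quat[OF this] show ?thesis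
    by (simp add: act_def quat_cnj_mult) (simp add: quat_mult_assoc)
qed

lemma orthogonal_act: "norm q = 1 \<Longrightarrow> orthogonal_transformation (act q)"
proof -
  assume q: "norm q = 1"
  then have "act q = (*v) (quat_rotation (quat_cnj q))" by (intro ext act_eq)
  with q show ?thesis using orthogonal_quat_rotation[of "quat_cnj q"] by simp
qed

lemma measurable_act_borel: "norm q = 1 \<Longrightarrow> act q \<in> borel_measurable borel"
  by (intro measurable_orthogonal_transformation orthogonal_act)

lemma distr_act: "norm q = 1 \<Longrightarrow> distr lborel borel (act q) = lborel"
  by (intro lborel_distr_orthogonal orthogonal_act)

lemma rotated_template_eq:
  "norm q = 1 \<Longrightarrow> rotated_template t (quat_rotation q) = (\<lambda>z. t (act q z))"
  by (simp add: rotated_template_def rotate_fun_def matrix_inv_quat_rotation act_eq)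

section \<open>Joint measurability in the quaternion and the point\<close>

lemma borel_measurable_vec_componentI:
  fixes f :: "'a \<Rightarrow> real^'n"
  assumes "\<And>i. (\<lambda>x. f x $ i) \<in> borel_measurable M"
  shows "f \<in> borel_measurable M"
  using assms
  by (subst borel_measurable_euclidean_space) (auto simp: Basis_vec_def inner_axis)

lemma borel_measurable_vec_nth [measurable (raw)]:
  fixes f :: "'a \<Rightarrow> real^'n"
  assumes "f \<in> borel_measurable M"
  shows "(\<lambda>x. f x $ i) \<in> borel_measurable M"
  using borel_measurable_inner[OF assms borel_measurable_const[of "axis i 1"]]
  by (simp add: inner_axis)

lemma borel_measurable_vector_3 [measurable (raw)]:
  fixes a b c :: "'a \<Rightarrow> real"
  assumes "a \<in> borel_measurable M" "b \<in> borel_measurable M" "c \<in> borel_measurable M"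
  shows "(\<lambda>x. vector [a x, b x, c x] :: real^3) \<in> borel_measurable M"
proof (rule borel_measurable_vec_componentI)
  show "(\<lambda>x. (vector [a x, b x, c x] :: real^3) $ i) \<in> borel_measurable M" for i
    using exhaust_3[of i] assms by auto
qed

lemma borel_measurable_vector_4 [measurable (raw)]:
  fixes a b c d :: "'a \<Rightarrow> real"
  assumes "a \<in> borel_measurable M" "b \<in> borel_measurable M" "c \<in> borel_measurable M"
    "d \<in> borel_measurable M"
  shows "(\<lambda>x. vector [a x, b x, c x, d x] :: real^4) \<in> borel_measurable M"
proof (rule borel_measurable_vec_componentI)
  show "(\<lambda>x. (vector [a x, b x, c x, d x] :: real^4) $ i) \<in> borel_measurable M" for i
    using exhaust_4[of i] assms by (auto simp: vector_4)
qed

lemma measurable_quat_mult [measurable (raw)]: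
  assumes [measurable]: "f \<in> borel_measurable M" "g \<in> borel_measurable M"
  shows "(\<lambda>x. quat_mult (f x) (g x)) \<in> borel_measurable M"
  unfolding quat_mult_def by measurable

lemma measurable_act [measurable (raw)]:
  assumes [measurable]: "f \<in> borel_measurable M" "g \<in> borel_measurable M"
  shows "(\<lambda>x. act (f x) (g x)) \<in> borel_measurable M"
  unfolding act_def quat_cnj_def quat_of_vec_def vec_of_quat_def by measurable

text \<open>A Cauchy-Schwarz estimate against the constant 1, obtained by expanding the nonnegative
  integral of \<open>(h x - c)^2\<close> at \<open>c = I / V\<close>.\<close>

lemma (in finite_measure) power2_integral_le:
  fixes h :: "'a \<Rightarrow> real"
  assumes [measurable]: "h \<in> borel_measurable M" and h2: "integrable M (\<lambda>x. (h x)\<^sup>2)"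
  shows "(\<integral>x. h x \<partial>M)\<^sup>2 \<le> (measure M (space M) + 1) * (\<integral>x. (h x)\<^sup>2 \<partial>M)"
proof -
  \<comment> \<open>The summand 1 keeps \<open>V\<close> positive even if the measure is zero, so
    that division by \<open>V\<close> is legitimate.\<close>
  define V where "V = measure M (space M) + 1"
  define I where "I = (\<integral>x. h x \<partial>M)"
  define J where "J = (\<integral>x. (h x)\<^sup>2 \<partial>M)"
  define c where "c = I / V"
  have V: "V > 0" unfolding V_def using measure_nonneg[of M "space M"] by linarith
  have h: "integrable M h" by (rule square_integrable_imp_integrable[OF _ h2]) simp
  have "0 \<le> (\<integral>x. (h x - c)\<^sup>2 \<partial>M)" by (rule integral_nonneg_AE) simp
  also have "(\<integral>x. (h x - c)\<^sup>2 \<partial>M) = (\<integral>x. (h x)\<^sup>2 + (c\<^sup>2 - 2 * c * h x) \<partial>M)"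
    by (intro Bochner_Integration.integral_cong) (auto simp: power2_diff)
  also have "\<dots> = J + (c\<^sup>2 * (V - 1) - 2 * c * I)"
    using h h2 by (simp add: J_def I_def V_def)
  also have "\<dots> \<le> J + (c\<^sup>2 * V - 2 * c * I)" by (simp add: algebra_simps)
  also have "c\<^sup>2 * V - 2 * c * I = - (I\<^sup>2 / V)"
    using V by (simp add: c_def field_simps power2_eq_square)
  finally have "I\<^sup>2 / V \<le> J" by simp
  then show ?thesis using V by (simp add: I_def J_def V_def field_simps)
qed

lemma measurable_ident_sphere: "(\<lambda>q. q) \<in> borel_measurable sphere_measure"
  by (intro measurable_sphere_measure) simp

lemma pair_sigma_finite_sphere: "pair_sigma_finite sphere_measure (lborel :: (real^3) measure)"
proof -
  interpret finite_measure sphere_measure by (rule finite_measure_sphere)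
  show ?thesis by unfold_locales
qed

lemma integrable_act_power2:
  fixes t :: "real^3 \<Rightarrow> real"
  assumes [measurable]: "t \<in> borel_measurable borel" and t2: "integrable lborel (\<lambda>z. (t z)\<^sup>2)"
    and q: "norm q = 1"
  shows "integrable lborel (\<lambda>z. (t (act q z))\<^sup>2)"
    and "(\<integral>z. (t (act q z))\<^sup>2 \<partial>lborel) = (\<integral>z. (t z)\<^sup>2 \<partial>lborel)"
proof -
  note [measurable] = measurable_act_borel[OF q]
  show "(\<integral>z. (t (act q z))\<^sup>2 \<partial>lborel) = (\<integral>z. (t z)\<^sup>2 \<partial>lborel)"
    by (rule integral_lborel_distr[where h="\<lambda>z. (t z)\<^sup>2"]) (simp_all add: distr_act q)
  have "integrable (distr lborel borel (act q)) (\<lambda>z. (t z)\<^sup>2)" using t2 q by (simp add: distr_act)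
  then show "integrable lborel (\<lambda>z. (t (act q z))\<^sup>2)"
    by (subst (asm) integrable_distr_eq) auto
qed

text \<open>All rotated copies of \<open>t\<close> have the same norm and the sphere has finite
  measure, so \<open>w(a) t(act a z)\<close> is square integrable on the product space. The
  Cauchy-Schwarz estimate over the sphere then makes \<open>G\<close> square integrable, and
  Fubini's theorem gives its pairing with \<open>h\<close>.\<close>

lemma sphere_superposition:
  fixes w :: "real^4 \<Rightarrow> real" and t :: "real^3 \<Rightarrow> real"
  defines "G \<equiv> \<lambda>z. \<integral>a. w a * t (act a z) \<partial>sphere_measure"
  assumes w[measurable]: "w \<in> borel_measurable borel" and wC: "\<And>q. norm q = 1 \<Longrightarrow> \<bar>w q\<bar> \<le> C"
    and t[measurable]: "t \<in> borel_measurable borel" and t2: "integrable lborel (\<lambda>z. (t z)\<^sup>2)"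
  shows "G \<in> borel_measurable borel" and "integrable lborel (\<lambda>z. (G z)\<^sup>2)"
    and "\<And>h. h \<in> borel_measurable borel \<Longrightarrow> integrable lborel (\<lambda>z. (h z)\<^sup>2) \<Longrightarrow>
      (\<integral>z. G z * h z \<partial>lborel) = (\<integral>a. w a * (\<integral>z. t (act a z) * h z \<partial>lborel) \<partial>sphere_measure)"
proof -
  interpret F: finite_measure sphere_measure by (rule finite_measure_sphere)
  interpret P: pair_sigma_finite sphere_measure "lborel :: (real^3) measure"
    by (rule pair_sigma_finite_sphere)
  let ?N = "sphere_measure \<Otimes>\<^sub>M (lborel :: (real^3) measure)"
  have [measurable]: "fst \<in> borel_measurable ?N"
    by (rule measurable_compose[OF measurable_fst measurable_ident_sphere])
  have [measurable]: "snd \<in> borel_measurable ?N" by measurable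
  have integrable_t2: "integrable ?N (\<lambda>p. (t (act (fst p) (snd p)))\<^sup>2)"
  proof (rule P.Fubini_integrable)
    have "integrable sphere_measure (\<lambda>a. \<integral>z. (t z)\<^sup>2 \<partial>lborel)" by simp
    then show "integrable sphere_measure
        (\<lambda>x. \<integral>y. norm ((t (act (fst (x, y)) (snd (x, y))))\<^sup>2) \<partial>lborel)"
      by (rule Bochner_Integration.integrable_cong[THEN iffD1, rotated -1])
         (auto simp: integrable_act_power2[OF t t2])
    show "AE x in sphere_measure. integrable lborel (\<lambda>y. (t (act (fst (x, y)) (snd (x, y))))\<^sup>2)"
      by (rule AE_I2) (auto simp: integrable_act_power2[OF t t2])
  qed measurable
  have wt2: "integrable ?N (\<lambda>p. (w (fst p) * t (act (fst p) (snd p)))\<^sup>2)"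
  proof (rule Bochner_Integration.integrable_bound)
    show "integrable ?N (\<lambda>p. C\<^sup>2 * (t (act (fst p) (snd p)))\<^sup>2)" using integrable_t2 by simp
    have "(w a)\<^sup>2 \<le> C\<^sup>2" if "norm a = 1" for a
      using wC[OF that] by (intro abs_le_square_iff[THEN iffD1]) linarith
    then show "AE p in ?N. norm ((w (fst p) * t (act (fst p) (snd p)))\<^sup>2)
        \<le> norm (C\<^sup>2 * (t (act (fst p) (snd p)))\<^sup>2)"
      by (intro AE_I2) (auto simp: space_pair_measure power_mult_distrib intro!: mult_right_mono)
  qed measurable
  have Gm: "G \<in> borel_measurable lborel"
    unfolding G_def
  proof (rule F.borel_measurable_lebesgue_integral)
    have [measurable]: "snd \<in> borel_measurable (lborel \<Otimes>\<^sub>M sphere_measure)"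
      by (rule measurable_compose[OF measurable_snd measurable_ident_sphere])
    have [measurable]: "fst \<in> borel_measurable (lborel \<Otimes>\<^sub>M sphere_measure)" by measurable
    show "(\<lambda>(z, a). w a * t (act a z)) \<in> borel_measurable (lborel \<Otimes>\<^sub>M sphere_measure)"
      by (simp add: case_prod_beta')
  qed
  then show "G \<in> borel_measurable borel" by simp
  show "integrable lborel (\<lambda>z. (G z)\<^sup>2)"
  proof (rule Bochner_Integration.integrable_bound)
    let ?J = "\<lambda>z. \<integral>a. (w a * t (act a z))\<^sup>2 \<partial>sphere_measure"
    let ?V = "measure sphere_measure (space sphere_measure) + 1"
    have wt2': "integrable ?N (\<lambda>(a, z). (w a * t (act a z))\<^sup>2)"
      using wt2 by (simp add: case_prod_beta')
    then have "integrable lborel ?J" by (rule P.integrable_snd)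
    then show "integrable lborel (\<lambda>z. ?V * ?J z)" by simp
    \<comment> \<open>Fubini's theorem gives square integrability in \<open>a\<close> only for
      almost every \<open>z\<close>, which suffices for domination.\<close>
    have "AE z in lborel. integrable sphere_measure (\<lambda>a. (w a * t (act a z))\<^sup>2)"
      using P.AE_integrable_snd[OF wt2'] .
    then show "AE z in lborel. norm ((G z)\<^sup>2) \<le> norm (?V * ?J z)"
    proof eventually_elim
      case (elim z)
      have "(G z)\<^sup>2 \<le> ?V * ?J z" unfolding G_def
        by (rule F.power2_integral_le[OF _ elim]) (rule measurable_sphere_measure, measurable)
      then show ?case using zero_le_power2[of "G z"] by (simp only: real_norm_def)
    qed
  qed (use Gm in measurable)
  fix h :: "real^3 \<Rightarrow> real"
  assume h[measurable]: "h \<in> borel_measurable borel" and h2: "integrable lborel (\<lambda>z. (h z)\<^sup>2)"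
  \<comment> \<open>\<open>h\<close> does not depend on the quaternion, so its square is integrable
    on the product because the sphere has finite measure. Both factors of the next integrand are
    then square integrable.\<close>
  have int_h2: "integrable ?N (\<lambda>p. (h (snd p))\<^sup>2)"
    by (rule P.Fubini_integrable) (use h2 in auto)
  have "integrable ?N (\<lambda>p. (w (fst p) * t (act (fst p) (snd p))) * h (snd p))"
    by (rule integrable_mult_of_power2) (use wt2 int_h2 in \<open>simp_all\<close>)
  then have "integrable ?N (\<lambda>(a, z). w a * t (act a z) * h z)" by (simp add: case_prod_beta')
  from P.Fubini_integral[OF this]
  have "(\<integral>z. \<integral>a. w a * t (act a z) * h z \<partial>sphere_measure \<partial>lborel)
      = (\<integral>a. \<integral>z. w a * (t (act a z) * h z) \<partial>lborel \<partial>sphere_measure)" by (simp add: mult.assoc)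
  then show "(\<integral>z. G z * h z \<partial>lborel)
      = (\<integral>a. w a * (\<integral>z. t (act a z) * h z \<partial>lborel) \<partial>sphere_measure)"
    by (simp add: G_def)
qed

section \<open>Positive semidefinite kernels on the sphere\<close>

text \<open>With \<open>t\<close> and \<open>s\<close> Borel representatives of the template and its
  image under \<open>S\<close>, this is the S-inner product of the templates rotated by
  \<open>a\<close> and \<open>b\<close>. Since \<open>S\<close> itself does not occur, joint
  measurability in \<open>a\<close> and \<open>b\<close> is that of a parametrized integral.\<close>

definition kern :: "(real^3 \<Rightarrow> real) \<Rightarrow> (real^3 \<Rightarrow> real) \<Rightarrow> real^4 \<Rightarrow> real^4 \<Rightarrow> real" where
  "kern t s a b = (\<integral>z. t (act a z) * s (act b z) \<partial>lborel)"

lemma measurable_kern: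
  assumes [measurable]: "t \<in> borel_measurable borel" "s \<in> borel_measurable borel"
  shows "(\<lambda>(a, b). kern t s a b) \<in> borel_measurable (borel \<Otimes>\<^sub>M borel)"
  unfolding kern_def case_prod_beta'
  by (rule lborel.borel_measurable_lebesgue_integral) (simp add: case_prod_beta')

lemma kern_bounded:
  assumes t[measurable]: "t \<in> borel_measurable borel" and t2: "integrable lborel (\<lambda>z. (t z)\<^sup>2)"
    and s[measurable]: "s \<in> borel_measurable borel" and s2: "integrable lborel (\<lambda>z. (s z)\<^sup>2)"
    and q: "norm a = 1" "norm b = 1"
  shows "\<bar>kern t s a b\<bar> \<le> (\<integral>z. (t z)\<^sup>2 \<partial>lborel) + (\<integral>z. (s z)\<^sup>2 \<partial>lborel)"
proof -
  note [measurable] = measurable_act_borel[OF q(1)] measurable_act_borel[OF q(2)]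
  note ta = integrable_act_power2[OF t t2 q(1)] and sb = integrable_act_power2[OF s s2 q(2)]
  have "\<bar>kern t s a b\<bar> \<le> (\<integral>z. \<bar>t (act a z) * s (act b z)\<bar> \<partial>lborel)"
    unfolding kern_def by (rule integral_abs_bound)
  also have "\<dots> \<le> (\<integral>z. (t (act a z))\<^sup>2 + (s (act b z))\<^sup>2 \<partial>lborel)"
    by (rule integral_mono) (use ta sb abs_mult_le_sum_squares in \<open>auto intro!: integrable_mult_of_power2\<close>)
  also have "\<dots> = (\<integral>z. (t z)\<^sup>2 \<partial>lborel) + (\<integral>z. (s z)\<^sup>2 \<partial>lborel)"
    using ta sb by simp
  finally show ?thesis .
qed

text \<open>Left multiplication by \<open>g\<close> precomposes both factors with the same
  measure-preserving map \<open>act g\<close>.\<close>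

lemma kern_quat_mult:
  assumes [measurable]: "t \<in> borel_measurable borel" "s \<in> borel_measurable borel"
    and g: "norm g = 1" and q: "norm a = 1" "norm b = 1"
  shows "kern t s (quat_mult g a) (quat_mult g b) = kern t s a b"
proof -
  note [measurable] = measurable_act_borel[OF q(1)] measurable_act_borel[OF q(2)]
    measurable_act_borel[OF g]
  show ?thesis unfolding kern_def act_mult
    by (rule integral_lborel_distr[where h="\<lambda>z. t (act a z) * s (act b z)"]) (simp_all add: distr_act g)
qed

lemma measurable_tensor_power [measurable (raw)]:
  assumes [measurable]: "f \<in> borel_measurable M"
  shows "(\<lambda>x. tensor_power n (f x) i) \<in> borel_measurable M"
  unfolding tensor_power_def by measurable

lemma abs_tensor_power_le_1: "norm q = 1 \<Longrightarrow> \<bar>tensor_power n q i\<bar> \<le> 1"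
  unfolding tensor_power_def abs_prod
  by (intro prod_le_1) (use component_le_norm_cart[of q] in auto)

lemma abs_integral_sphere_le:
  fixes h :: "real^4 \<Rightarrow> real"
  assumes "h \<in> borel_measurable borel" and C: "\<And>q. norm q = 1 \<Longrightarrow> \<bar>h q\<bar> \<le> C"
  shows "\<bar>\<integral>q. h q \<partial>sphere_measure\<bar> \<le> C * measure sphere_measure (sphere 0 1)"
proof -
  interpret finite_measure sphere_measure by (rule finite_measure_sphere)
  have "\<bar>\<integral>q. h q \<partial>sphere_measure\<bar> \<le> (\<integral>q. \<bar>h q\<bar> \<partial>sphere_measure)"
    by (rule integral_abs_bound)
  also have "\<dots> \<le> (\<integral>q. C \<partial>sphere_measure)"
    by (rule integral_mono) (use integrable_sphere_bounded[OF assms] C in auto)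
  finally show ?thesis by (simp add: mult.commute)
qed

text \<open>The maximality argument, separated from the operator. Positivity is phrased with bounded
  weight functions because the components of the tensors are used as weights.\<close>

lemma invariant_kernel_maximum:
  fixes K :: "real^4 \<Rightarrow> real^4 \<Rightarrow> real"
  assumes measK: "(\<lambda>(a, b). K a b) \<in> borel_measurable (borel \<Otimes>\<^sub>M borel)"
    and bound: "\<And>a b. norm a = 1 \<Longrightarrow> norm b = 1 \<Longrightarrow> \<bar>K a b\<bar> \<le> C"
    and sym: "\<And>a b. norm a = 1 \<Longrightarrow> norm b = 1 \<Longrightarrow> K a b = K b a"
    and inv: "\<And>g a b. norm g = 1 \<Longrightarrow> norm a = 1 \<Longrightarrow> norm b = 1 \<Longrightarrow>
      K (quat_mult g a) (quat_mult g b) = K a b"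
    and pos: "\<And>w B. w \<in> borel_measurable borel \<Longrightarrow> (\<And>q. norm q = 1 \<Longrightarrow> \<bar>w q\<bar> \<le> B) \<Longrightarrow>
      0 \<le> (\<integral>a. w a * (\<integral>b. w b * K a b \<partial>sphere_measure) \<partial>sphere_measure)"
    and R: "norm R = 1" and Q: "norm Q = 1"
  shows "(\<integral>q. (q \<bullet> Q) ^ n * K R q \<partial>sphere_measure) \<le> (\<integral>q. (q \<bullet> R) ^ n * K R q \<partial>sphere_measure)"
proof -
  interpret F: finite_measure sphere_measure by (rule finite_measure_sphere)
  have [measurable (raw)]: "(\<lambda>x. K (f x) (g x)) \<in> borel_measurable M"
    if "f \<in> borel_measurable M" "g \<in> borel_measurable M" for f g and M :: "'c measure"
    using measurable_compose[OF measurable_Pair[OF that] measK] by simp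
  let ?I = "{..<n} \<rightarrow>\<^sub>E (UNIV :: 4 set)"
  define V where "V = measure sphere_measure (sphere 0 1)"
  \<comment> \<open>Right multiplication by \<open>P\<close> sends \<open>R\<close> to
    \<open>Q\<close> and commutes with the left multiplications that leave \<open>K\<close>
    invariant.\<close>
  define P where "P = quat_mult (quat_cnj R) Q"
  have P: "norm P = 1" using R Q by (simp add: P_def norm_quat_mult)
  have RP: "quat_mult R P = Q"
    using R by (simp add: P_def quat_mult_cnj_right flip: quat_mult_assoc)
  define w where "w i a = tensor_power n a i - tensor_power n (quat_mult a P) i" for i a
  define W where "W a b = (\<Sum>i\<in>?I. w i a * w i b)" for a b
  have w_meas[measurable (raw)]: "(\<lambda>x. w i (f x)) \<in> borel_measurable M"
    if [measurable]: "f \<in> borel_measurable M" for i f and M :: "'c measure"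
    unfolding w_def by measurable
  have w_bound: "\<bar>w i q\<bar> \<le> 2" if "norm q = 1" for i q
    using abs_tensor_power_le_1[OF that, of n i]
      abs_tensor_power_le_1[OF norm_quat_mult[OF that P], of n i]
    unfolding w_def by linarith
  have C0: "0 \<le> C" using bound[OF R R] by linarith
  have wK_bound: "\<bar>w i b * K a b\<bar> \<le> 2 * C" if "norm a = 1" "norm b = 1" for i a b
    unfolding abs_mult by (intro mult_mono w_bound bound that) simp_all
  have wK_int: "integrable sphere_measure (\<lambda>b. w i b * K a b)" if "norm a = 1" for i a
    using wK_bound[OF that] by (intro integrable_sphere_bounded) auto
  \<comment> \<open>Contraction over the multi-indices turns the weights into powers of inner
    products, which left multiplication by a unit quaternion preserves.\<close>
  have W_eq: "W a b = (a \<bullet> b) ^ n - (a \<bullet> quat_mult b P) ^ n - (quat_mult a P \<bullet> b) ^ n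
      + (quat_mult a P \<bullet> quat_mult b P) ^ n" for a b
    unfolding tensor_dot_tensor_power[symmetric] tensor_dot_def W_def w_def
    by (simp add: algebra_simps sum.distrib sum_subtractf)
  define J where "J a = (\<integral>b. W a b * K a b \<partial>sphere_measure)" for a
  have J_eq: "J a = (\<Sum>i\<in>?I. w i a * (\<integral>b. w i b * K a b \<partial>sphere_measure))" if "norm a = 1" for a
  proof -
    have "J a = (\<integral>b. (\<Sum>i\<in>?I. w i a * (w i b * K a b)) \<partial>sphere_measure)"
      by (simp add: J_def W_def sum_distrib_right mult.assoc)
    also have "\<dots> = (\<Sum>i\<in>?I. \<integral>b. w i a * (w i b * K a b) \<partial>sphere_measure)"
      using wK_int[OF that] by (intro Bochner_Integration.integral_sum) auto
    finally show ?thesis by simp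
  qed
  have inner_int: "integrable sphere_measure
      (\<lambda>a. w i a * (\<integral>b. w i b * K a b \<partial>sphere_measure))" for i
  proof (rule integrable_sphere_bounded)
    have [measurable]: "(\<lambda>a. \<integral>b. w i b * K a b \<partial>sphere_measure) \<in> borel_measurable borel"
    proof (rule F.borel_measurable_lebesgue_integral)
      have [measurable]: "snd \<in> borel_measurable (borel \<Otimes>\<^sub>M sphere_measure)"
        by (rule measurable_compose[OF measurable_snd measurable_ident_sphere])
      show "(\<lambda>(a, b). w i b * K a b) \<in> borel_measurable (borel \<Otimes>\<^sub>M sphere_measure)"
        unfolding case_prod_beta' by measurable
    qed
    show "(\<lambda>a. w i a * (\<integral>b. w i b * K a b \<partial>sphere_measure)) \<in> borel_measurable borel"
      by measurable
    show "\<bar>w i a * (\<integral>b. w i b * K a b \<partial>sphere_measure)\<bar> \<le> 2 * (2 * C * V)" if "norm a = 1" for a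
      unfolding abs_mult V_def
      by (intro mult_mono w_bound that abs_integral_sphere_le wK_bound) auto
  qed
  have J_const: "J a = J R" if a: "norm a = 1" for a
  proof -
    \<comment> \<open>\<open>g\<close> is the left multiplier taking \<open>R\<close> to
      \<open>a\<close>; substituting \<open>quat_mult g b\<close> for \<open>b\<close> moves the
      base point from \<open>a\<close> to \<open>R\<close>.\<close>
    define g where "g = quat_mult a (quat_cnj R)"
    have g: "norm g = 1" using a R by (simp add: g_def norm_quat_mult)
    have gR: "quat_mult g R = a" using R by (simp add: g_def quat_mult_assoc quat_mult_cnj_left)
    have "J a = (\<integral>b. W a (quat_mult g b) * K a (quat_mult g b) \<partial>sphere_measure)"
      unfolding J_def
      by (rule integral_sphere_orthogonal[OF orthogonal_quat_mult_left[OF g], symmetric])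
         (unfold W_def, measurable)
    also have "\<dots> = (\<integral>b. W R b * K R b \<partial>sphere_measure)"
    proof (rule Bochner_Integration.integral_cong[OF refl])
      fix b assume "b \<in> space sphere_measure"
      then have b: "norm b = 1" by simp
      have "g \<bullet> g = 1" using g by (simp add: norm_eq_1)
      then have "W (quat_mult g R) (quat_mult g b) = W R b"
        by (simp add: W_eq quat_mult_assoc inner_quat_mult_left)
      moreover have "K (quat_mult g R) (quat_mult g b) = K R b" by (rule inv[OF g R b])
      ultimately show "W a (quat_mult g b) * K a (quat_mult g b) = W R b * K R b"
        by (simp add: gR)
    qed
    finally show ?thesis by (simp add: J_def)
  qed
  have "0 \<le> (\<Sum>i\<in>?I. \<integral>a. w i a * (\<integral>b. w i b * K a b \<partial>sphere_measure) \<partial>sphere_measure)"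
  proof (rule sum_nonneg)
    fix i
    have "w i \<in> borel_measurable borel" using w_meas[of "\<lambda>q. q" borel i] by simp
    then show "0 \<le> (\<integral>a. w i a * (\<integral>b. w i b * K a b \<partial>sphere_measure) \<partial>sphere_measure)"
      by (rule pos) (rule w_bound)
  qed
  also have "\<dots> = (\<integral>a. (\<Sum>i\<in>?I. w i a * (\<integral>b. w i b * K a b \<partial>sphere_measure)) \<partial>sphere_measure)"
    using inner_int by (intro Bochner_Integration.integral_sum[symmetric]) auto
  \<comment> \<open>Since \<open>J\<close> is constant on the sphere, the outer integration only
    contributes the total mass \<open>V\<close>.\<close>
  also have "\<dots> = (\<integral>a. J R \<partial>sphere_measure)"
    by (intro Bochner_Integration.integral_cong refl) (simp add: J_eq[symmetric] J_const)
  finally have VJ: "0 \<le> V * J R" by (simp add: V_def)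
  define \<phi> where "\<phi> Q = (\<integral>q. (q \<bullet> Q) ^ n * K R q \<partial>sphere_measure)" for Q
  have p_bound: "\<bar>(b \<bullet> Q) ^ n * K R b\<bar> \<le> C" if b: "norm b = 1" and Q: "norm Q = 1" for b Q
  proof -
    have "\<bar>b \<bullet> Q\<bar> \<le> 1" using Cauchy_Schwarz_ineq2[of b Q] b Q by simp
    then have "\<bar>b \<bullet> Q\<bar> ^ n \<le> 1" by (intro power_le_one) auto
    then show ?thesis using mult_mono[OF _ bound[OF R b], of "\<bar>b \<bullet> Q\<bar> ^ n" 1]
      by (simp add: abs_mult power_abs)
  qed
  have phi_int: "integrable sphere_measure (\<lambda>q. (q \<bullet> Q) ^ n * K R q)" if "norm Q = 1" for Q
    by (rule integrable_sphere_bounded[OF _ p_bound]) (use that in auto)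
  \<comment> \<open>The reflection \<open>b \<mapsto> R b\<^sup>* R\<close> fixes \<open>R\<close> and exchanges the two arguments of \<open>K\<close>.\<close>
  define T where "T b = quat_mult R (quat_mult (quat_cnj b) R)" for b
  have T: "orthogonal_transformation T"
    using orthogonal_transformation_compose[OF orthogonal_quat_mult_left[OF R]
        orthogonal_transformation_compose[OF orthogonal_quat_mult_right[OF R] orthogonal_quat_cnj]]
    by (simp add: T_def[abs_def] o_def)
  have T_eq: "(R \<bullet> quat_mult (T b) P) ^ n * K R (T b) = (b \<bullet> Q) ^ n * K R b"
    if b: "norm b = 1" for b
  proof -
    let ?e = "vector [1, 0, 0, 0] :: real^4"
    have e: "norm ?e = 1" using norm_quat_mult[of "quat_cnj b" b] b by (simp add: quat_mult_cnj_left)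
    have RR: "R \<bullet> R = 1" "b \<bullet> b = 1" using R b by (simp_all add: norm_eq_1)
    \<comment> \<open>\<open>R P = Q\<close> gives \<open>(T b) P = R b* Q\<close>, with
      \<open>b*\<close> the conjugate. Cancelling the left factor \<open>R\<close> and then
      multiplying both sides of the inner product by \<open>b\<close> leaves \<open>b\<close>
      against \<open>Q\<close>.\<close>
    have "R \<bullet> quat_mult (T b) P = quat_mult R ?e \<bullet> quat_mult R (quat_mult (quat_cnj b) Q)"
      by (simp add: T_def quat_mult_assoc RP)
    also have "\<dots> = ?e \<bullet> quat_mult (quat_cnj b) Q"
      unfolding inner_quat_mult_left using RR by simp
    also have "\<dots> = quat_mult b ?e \<bullet> quat_mult b (quat_mult (quat_cnj b) Q)"
      unfolding inner_quat_mult_left using RR by simp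
    also have "\<dots> = b \<bullet> Q" using b by (simp add: quat_mult_cnj_right flip: quat_mult_assoc)
    finally have 1: "R \<bullet> quat_mult (T b) P = b \<bullet> Q" .
    have bR: "norm (quat_mult (quat_cnj b) R) = 1" using b R by (simp add: norm_quat_mult)
    \<comment> \<open>The same two left multiplications, by the inverse of \<open>R\<close> and then
      by \<open>b\<close>, turn the kernel value into \<open>K b R\<close>; symmetry
      finishes.\<close>
    have "K R (T b) = K (quat_mult R ?e) (quat_mult R (quat_mult (quat_cnj b) R))"
      by (simp add: T_def)
    also have "\<dots> = K ?e (quat_mult (quat_cnj b) R)" by (rule inv[OF R e bR])
    also have "\<dots> = K (quat_mult b ?e) (quat_mult b (quat_mult (quat_cnj b) R))"
      by (rule inv[OF b e bR, symmetric])
    also have "\<dots> = K b R" using b by (simp add: quat_mult_cnj_right flip: quat_mult_assoc)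
    also have "\<dots> = K R b" by (rule sym[OF b R])
    finally show ?thesis using 1 by simp
  qed
  have refl_int: "(\<integral>b. (R \<bullet> quat_mult b P) ^ n * K R b \<partial>sphere_measure) = \<phi> Q"
  proof -
    have "(\<integral>b. (R \<bullet> quat_mult b P) ^ n * K R b \<partial>sphere_measure)
        = (\<integral>b. (R \<bullet> quat_mult (T b) P) ^ n * K R (T b) \<partial>sphere_measure)"
      by (rule integral_sphere_orthogonal[OF T, symmetric]) measurable
    also have "\<dots> = \<phi> Q" unfolding \<phi>_def
      by (intro Bochner_Integration.integral_cong refl) (simp add: T_eq)
    finally show ?thesis .
  qed
  have RbP: "integrable sphere_measure (\<lambda>b. (R \<bullet> quat_mult b P) ^ n * K R b)"
  proof (rule integrable_sphere_bounded)
    show "\<bar>(R \<bullet> quat_mult b P) ^ n * K R b\<bar> \<le> C" if b: "norm b = 1" for b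
    proof -
      \<comment> \<open>The adjoint of right multiplication by \<open>P\<close> is right
        multiplication by its conjugate, which reduces the bound to \<open>p_bound\<close> at
        another unit quaternion.\<close>
      have "R \<bullet> quat_mult b P = quat_mult (quat_mult R (quat_cnj P)) P \<bullet> quat_mult b P"
        using P by (simp add: quat_mult_assoc quat_mult_cnj_left)
      also have "\<dots> = b \<bullet> quat_mult R (quat_cnj P)"
        unfolding inner_quat_mult_right using P by (simp add: norm_eq_1 inner_commute)
      finally show ?thesis
        using p_bound[OF b, of "quat_mult R (quat_cnj P)"] P R by (simp add: norm_quat_mult)
    qed
  qed measurable
  \<comment> \<open>At \<open>a = R\<close> the fourth term of \<open>W\<close> equals the first,
    since right multiplication by \<open>P\<close> is an isometry, and the third is a power of the
    inner product of \<open>b\<close> and \<open>Q\<close>. The second integrates to the same value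
    by \<open>refl_int\<close>.\<close>
  have "W R b * K R b = 2 * ((b \<bullet> R) ^ n * K R b) - (R \<bullet> quat_mult b P) ^ n * K R b
      - (b \<bullet> Q) ^ n * K R b" for b
  proof -
    have "quat_mult R P \<bullet> quat_mult b P = b \<bullet> R"
      unfolding inner_quat_mult_right using P by (simp add: norm_eq_1 inner_commute)
    then show ?thesis
      by (simp add: W_eq RP inner_commute algebra_simps)
  qed
  then have "J R = 2 * \<phi> R - \<phi> Q - \<phi> Q"
    using phi_int[OF R] phi_int[OF Q] RbP refl_int by (simp add: J_def \<phi>_def)
  then have "J R = 2 * (\<phi> R - \<phi> Q)" by simp
  with VJ have main: "0 \<le> V * (\<phi> R - \<phi> Q)" by (simp only: zero_le_mult_iff) auto
  have "\<phi> Q \<le> \<phi> R"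
  \<comment> \<open>If the total mass were zero, both integrals would vanish, so its value need not
    be computed.\<close>
  proof (cases "V = 0")
    case True
    have "\<bar>\<phi> q\<bar> \<le> C * V" if "norm q = 1" for q
      unfolding \<phi>_def V_def by (rule abs_integral_sphere_le) (use p_bound that in auto)
    from this[OF R] this[OF Q] True show ?thesis by simp
  next
    case False
    then have "V > 0" by (simp add: V_def zero_less_measure_iff)
    with main show ?thesis by (simp add: zero_le_mult_iff)
  qed
  then show ?thesis by (simp add: \<phi>_def)
qed

section \<open>The form of an SSP operator\<close>

lemma SSP_in_L2: "SSP S \<Longrightarrow> f \<in> L2_space \<Longrightarrow> S f \<in> L2_space"
  by (simp add: SSP_def L2_linear_def)

lemma SSP_inner_commute:
  "SSP S \<Longrightarrow> f \<in> L2_space \<Longrightarrow> g \<in> L2_space \<Longrightarrow> inner_S S f g = inner_S S g f"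
  by (simp add: SSP_def inner_S_def L2_inner_commute)

lemma inner_S_add_right:
  assumes S: "SSP S" and f: "f \<in> L2_space" and g: "g \<in> L2_space" and h: "h \<in> L2_space"
  shows "inner_S S f (\<lambda>z. g z + h z) = inner_S S f g + inner_S S f h"
proof -
  have "ae_eq (S (\<lambda>z. g z + h z)) (\<lambda>z. S g z + S h z)"
    using S g h by (simp add: SSP_def L2_linear_def)
  then have "inner_S S f (\<lambda>z. g z + h z) = L2_inner f (\<lambda>z. S g z + S h z)"
    unfolding inner_S_def
    by (intro L2_inner_cong_AE f SSP_in_L2[OF S] L2_space_add g h)
  then show ?thesis
    by (simp add: inner_S_def L2_inner_add_right SSP_in_L2[OF S] f g h)
qed

lemma inner_S_scale_right:
  assumes S: "SSP S" and f: "f \<in> L2_space" and g: "g \<in> L2_space"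
  shows "inner_S S f (\<lambda>z. c * g z) = c * inner_S S f g"
proof -
  have "ae_eq (S (\<lambda>z. c * g z)) (\<lambda>z. c * S g z)"
    using S g by (simp add: SSP_def L2_linear_def)
  then have "inner_S S f (\<lambda>z. c * g z) = L2_inner f (\<lambda>z. c * S g z)"
    unfolding inner_S_def
    by (intro L2_inner_cong_AE f SSP_in_L2[OF S] L2_space_scale g)
  then show ?thesis by (simp add: inner_S_def L2_inner_scale_right)
qed

lemma inner_S_add_left:
  assumes "SSP S" "f \<in> L2_space" "g \<in> L2_space" "h \<in> L2_space"
  shows "inner_S S (\<lambda>z. g z + h z) f = inner_S S g f + inner_S S h f"
  using assms inner_S_add_right[of S f g h]
  by (simp add: SSP_inner_commute[of S _ f] L2_space_add)

lemma inner_S_scale_left: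
  assumes "SSP S" "f \<in> L2_space" "g \<in> L2_space"
  shows "inner_S S (\<lambda>z. c * g z) f = c * inner_S S g f"
  using assms inner_S_scale_right[of S f g c]
  by (simp add: SSP_inner_commute[of S _ f] L2_space_scale)

lemma inner_S_nonneg: "SSP S \<Longrightarrow> f \<in> L2_space \<Longrightarrow> 0 \<le> inner_S S f f"
  unfolding SSP_def inner_S_def by blast

lemma quadratic_nonneg_imp_linear_coeff_zero:
  fixes a b :: real
  assumes "\<And>c. 0 \<le> a + 2 * c * b"
  shows "b = 0"
proof (rule ccontr)
  assume "b \<noteq> 0"
  \<comment> \<open>At this value of \<open>c\<close> the affine expression would equal -1.\<close>
  then have "2 * (- (a + 1) / (2 * b)) * b = - (a + 1)" by simp
  then show False using assms[of "- (a + 1) / (2 * b)"] by linarith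
qed

text \<open>For a semidefinite form, a vector of S-norm 0 is orthogonal to everything: along
  \<open>g + c h\<close> the quadratic term vanishes, and an affine function of \<open>c\<close>
  that stays nonnegative has slope 0.\<close>

lemma inner_S_null:
  assumes S: "SSP S" and h: "h \<in> L2_space" and g: "g \<in> L2_space" and 0: "inner_S S h h = 0"
  shows "inner_S S h g = 0"
proof (rule quadratic_nonneg_imp_linear_coeff_zero)
  fix c
  have ch: "(\<lambda>z. c * h z) \<in> L2_space" using h by (rule L2_space_scale)
  have "0 \<le> inner_S S (\<lambda>z. g z + c * h z) (\<lambda>z. g z + c * h z)"
    by (intro inner_S_nonneg S L2_space_add g ch)
  also have "\<dots> = inner_S S g g + 2 * c * inner_S S h g"
    using SSP_inner_commute[OF S g h]
    by (simp add: inner_S_add_left[OF S] inner_S_add_right[OF S] inner_S_scale_left[OF S]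
        inner_S_scale_right[OF S] L2_space_add g h ch 0)
  finally show "0 \<le> inner_S S g g + 2 * c * inner_S S h g" .
qed

section \<open>Rotation invariance of the form\<close>

lemma act_one: "act (vector [1, 0, 0, 0]) z = z"
  by (simp add: act_def quat_cnj_def quat_mult_def quat_of_vec_def vec_of_quat_def vec_eq_iff
      forall_3 vector_4)

lemma L2_space_act: "norm q = 1 \<Longrightarrow> t \<in> L2_space \<Longrightarrow> (\<lambda>z. t (act q z)) \<in> L2_space"
  by (rule L2_space_distr[OF measurable_act_borel distr_act])

lemma S_act:
  assumes "commutes_with_rotations S" "t \<in> L2_space" "norm q = 1"
  shows "ae_eq (S (\<lambda>z. t (act q z))) (\<lambda>z. S t (act q z))"
proof -
  have "rotate_fun (quat_rotation (quat_cnj q)) f = (\<lambda>z. f (act q z))" for f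
    using assms(3) by (simp add: rotate_fun_def act_eq)
  moreover have "rotation_matrix (quat_rotation (quat_cnj q))"
    using assms(3) by (intro rotation_matrix_quat_rotation) simp
  ultimately show ?thesis
    using assms(1,2) unfolding commutes_with_rotations_def by metis
qed

lemma inner_S_act:
  assumes S: "SSP S" and com: "commutes_with_rotations S"
    and f: "f \<in> L2_space" and t: "t \<in> L2_space" and q: "norm q = 1"
  shows "inner_S S f (\<lambda>z. t (act q z)) = L2_inner f (\<lambda>z. S t (act q z))"
  unfolding inner_S_def
  by (rule L2_inner_cong_AE[OF f SSP_in_L2[OF S L2_space_act[OF q t]]
        L2_space_act[OF q SSP_in_L2[OF S t]] S_act[OF com t q]])

text \<open>The rotation is moved out of \<open>S\<close> by commutation and then removed from the
  integral as a measure-preserving substitution.\<close>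

lemma inner_S_act_act:
  assumes S: "SSP S" and com: "commutes_with_rotations S"
    and f: "f \<in> L2_space" and t: "t \<in> L2_space" and q: "norm q = 1"
  shows "inner_S S (\<lambda>z. f (act q z)) (\<lambda>z. t (act q z)) = inner_S S f t"
proof -
  have "inner_S S (\<lambda>z. f (act q z)) (\<lambda>z. t (act q z)) = L2_inner (\<lambda>z. f (act q z)) (\<lambda>z. S t (act q z))"
    by (rule inner_S_act[OF S com L2_space_act[OF q f] t q])
  also have "\<dots> = L2_inner f (S t)"
    by (rule L2_inner_distr[OF measurable_act_borel[OF q] distr_act[OF q] f SSP_in_L2[OF S t]])
  finally show ?thesis by (simp add: inner_S_def)
qed

text \<open>Each \<open>S\<close> applied to a rotated template is determined only up to a null set
  depending on the rotation. Commutation with rotations lets the single representative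
  \<open>s'\<close> of \<open>S t\<close>, composed with \<open>act q\<close>, serve for all
  \<open>q\<close> at once, which gives joint measurability.\<close>

locale borel_representatives =
  fixes S :: "(real^3 \<Rightarrow> real) \<Rightarrow> (real^3 \<Rightarrow> real)" and t t' s' :: "real^3 \<Rightarrow> real"
  assumes S: "SSP S" and com: "commutes_with_rotations S" and t: "t \<in> L2_space"
    and t': "t' \<in> borel_measurable borel" "integrable lborel (\<lambda>z. (t' z)\<^sup>2)"
      "AE z in lborel. t z = t' z"
    and s': "s' \<in> borel_measurable borel" "integrable lborel (\<lambda>z. (s' z)\<^sup>2)"
      "AE z in lborel. S t z = s' z"
begin

lemma AE_act:
  assumes q: "norm q = 1"
  shows "AE z in lborel. t (act q z) = t' (act q z)"
    and "AE z in lborel. S t (act q z) = s' (act q z)"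
    and "AE z in lborel. S (\<lambda>z. t (act q z)) z = s' (act q z)"
proof -
  show "AE z in lborel. t (act q z) = t' (act q z)"
    by (rule AE_lborel_distr[OF measurable_act_borel[OF q] distr_act[OF q] t'(3)])
  show *: "AE z in lborel. S t (act q z) = s' (act q z)"
    by (rule AE_lborel_distr[OF measurable_act_borel[OF q] distr_act[OF q] s'(3)])
  have "AE z in lborel. S (\<lambda>z. t (act q z)) z = S t (act q z)"
    using S_act[OF com t q] by (simp add: ae_eq_def AE_completion_iff)
  with * show "AE z in lborel. S (\<lambda>z. t (act q z)) z = s' (act q z)" by eventually_elim simp
qed

lemma measurable_act_reps:
  assumes q: "norm q = 1"
  shows "(\<lambda>z. t' (act q z)) \<in> borel_measurable borel" "(\<lambda>z. s' (act q z)) \<in> borel_measurable borel"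
  by (rule measurable_compose[OF measurable_act_borel[OF q]], rule t'(1) s'(1))+

lemma kern_eq_inner_S:
  assumes a: "norm a = 1" and b: "norm b = 1"
  shows "kern t' s' a b = inner_S S (\<lambda>z. t (act a z)) (\<lambda>z. t (act b z))"
  unfolding kern_def inner_S_def
  by (rule L2_inner_eq_lborel[OF L2_space_act[OF a t] SSP_in_L2[OF S L2_space_act[OF b t]]
        measurable_act_reps(1)[OF a] measurable_act_reps(2)[OF b] AE_act(1)[OF a] AE_act(3)[OF b],
        symmetric])

lemma kern_commute:
  assumes "norm a = 1" "norm b = 1"
  shows "kern t' s' a b = kern t' s' b a"
  unfolding kern_eq_inner_S[OF assms] kern_eq_inner_S[OF assms(2,1)]
  by (rule SSP_inner_commute[OF S L2_space_act[OF assms(1) t] L2_space_act[OF assms(2) t]])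

text \<open>The integral is \<open>\<langle>G, S G\<rangle>\<close> for the superposition \<open>G = \<integral> w(a) t\<^sub>a da\<close>. Symmetry of \<open>S\<close> lets
  \<open>S\<close> act on \<open>t\<^sub>a\<close> instead of \<open>G\<close>, so that continuity of \<open>S\<close> is not needed to exchange it with the
  integral.\<close>

lemma kern_positive:
  assumes w: "w \<in> borel_measurable borel" and wB: "\<And>q. norm q = 1 \<Longrightarrow> \<bar>w q\<bar> \<le> B"
  shows "0 \<le> (\<integral>a. w a * (\<integral>b. w b * kern t' s' a b \<partial>sphere_measure) \<partial>sphere_measure)"
proof -
  define G where "G = (\<lambda>z. \<integral>a. w a * t' (act a z) \<partial>sphere_measure)"
  have G: "G \<in> borel_measurable borel" "integrable lborel (\<lambda>z. (G z)\<^sup>2)"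
    unfolding G_def by (rule sphere_superposition(1,2)[OF w _ t'(1,2)], erule wB)+
  have Gh: "(\<integral>z. G z * h z \<partial>lborel)
      = (\<integral>a. w a * (\<integral>z. t' (act a z) * h z \<partial>lborel) \<partial>sphere_measure)"
    if "h \<in> borel_measurable borel" "integrable lborel (\<lambda>z. (h z)\<^sup>2)" for h
    unfolding G_def by (rule sphere_superposition(3)[OF w _ t'(1,2) that], erule wB)
  have GL: "G \<in> L2_space" by (rule L2_spaceI[OF G(1,2)]) simp
  obtain h where h: "h \<in> borel_measurable borel" "integrable lborel (\<lambda>z. (h z)\<^sup>2)"
    "AE z in lborel. S G z = h z" using SSP_in_L2[OF S GL] by (rule L2_spaceE)
  have *: "(\<integral>z. t' (act a z) * h z \<partial>lborel) = (\<integral>b. w b * kern t' s' a b \<partial>sphere_measure)"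
    if a: "norm a = 1" for a
  proof -
    have ta: "(\<lambda>z. t (act a z)) \<in> L2_space" using a t by (rule L2_space_act)
    have "(\<integral>z. t' (act a z) * h z \<partial>lborel) = inner_S S (\<lambda>z. t (act a z)) G"
      unfolding inner_S_def
      by (rule L2_inner_eq_lborel[OF ta SSP_in_L2[OF S GL] measurable_act_reps(1)[OF a] h(1)
            AE_act(1)[OF a] h(3), symmetric])
    also have "\<dots> = inner_S S G (\<lambda>z. t (act a z))" by (intro SSP_inner_commute S GL ta)
    also have "\<dots> = (\<integral>z. G z * s' (act a z) \<partial>lborel)"
      unfolding inner_S_def
      by (rule L2_inner_eq_lborel[OF GL SSP_in_L2[OF S ta] G(1) measurable_act_reps(2)[OF a]
            AE_I2 AE_act(3)[OF a]]) simp
    also have "\<dots> = (\<integral>b. w b * (\<integral>z. t' (act b z) * s' (act a z) \<partial>lborel) \<partial>sphere_measure)"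
      using measurable_act_reps(2)[OF a] integrable_act_power2(1)[OF s'(1,2) a] by (rule Gh)
    also have "\<dots> = (\<integral>b. w b * kern t' s' a b \<partial>sphere_measure)"
    proof (intro Bochner_Integration.integral_cong refl)
      fix b assume "b \<in> space sphere_measure"
      then have "kern t' s' b a = kern t' s' a b" by (intro kern_commute a) simp
      then show "w b * (\<integral>z. t' (act b z) * s' (act a z) \<partial>lborel) = w b * kern t' s' a b"
        by (simp only: kern_def)
    qed
    finally show ?thesis .
  qed
  have "0 \<le> L2_inner G (S G)" using inner_S_nonneg[OF S GL] by (simp add: inner_S_def)
  also have "\<dots> = (\<integral>z. G z * h z \<partial>lborel)"
    by (rule L2_inner_eq_lborel[OF GL SSP_in_L2[OF S GL] G(1) h(1) AE_I2 h(3)]) simp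
  also have "\<dots> = (\<integral>a. w a * (\<integral>z. t' (act a z) * h z \<partial>lborel) \<partial>sphere_measure)"
    using h(1,2) by (rule Gh)
  also have "\<dots> = (\<integral>a. w a * (\<integral>b. w b * kern t' s' a b \<partial>sphere_measure) \<partial>sphere_measure)"
    by (intro Bochner_Integration.integral_cong refl) (simp add: *)
  finally show ?thesis .
qed

lemma kern_maximum:
  assumes "norm R = 1" "norm Q = 1"
  shows "(\<integral>q. (q \<bullet> Q) ^ n * kern t' s' R q \<partial>sphere_measure)
    \<le> (\<integral>q. (q \<bullet> R) ^ n * kern t' s' R q \<partial>sphere_measure)"
proof (rule invariant_kernel_maximum)
  show "(\<lambda>(a, b). kern t' s' a b) \<in> borel_measurable (borel \<Otimes>\<^sub>M borel)"
    by (rule measurable_kern[OF t'(1) s'(1)])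
  show "\<bar>kern t' s' a b\<bar> \<le> (\<integral>z. (t' z)\<^sup>2 \<partial>lborel) + (\<integral>z. (s' z)\<^sup>2 \<partial>lborel)"
    if "norm a = 1" "norm b = 1" for a b
    by (rule kern_bounded[OF t'(1,2) s'(1,2) that])
  show "kern t' s' (quat_mult g a) (quat_mult g b) = kern t' s' a b"
    if "norm g = 1" "norm a = 1" "norm b = 1" for g a b
    by (rule kern_quat_mult[OF t'(1) s'(1) that])
  show "0 \<le> (\<integral>a. w a * (\<integral>b. w b * kern t' s' a b \<partial>sphere_measure) \<partial>sphere_measure)"
    if "w \<in> borel_measurable borel" "\<And>q. norm q = 1 \<Longrightarrow> \<bar>w q\<bar> \<le> B" for w B
    using that by (rule kern_positive)
qed (rule kern_commute assms; assumption?)+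

end

text \<open>The functions \<open>1\<^sub>F\<close> and \<open>1\<^sub>E\<close> with \<open>F = {z. act q z \<in> E}\<close> differ by \<open>1\<^bsub>F-E\<^esub> - 1\<^bsub>E-F\<^esub>\<close>; the first
  summand vanishes on \<open>E\<close>, and so does the second one after rotation. Hence \<open>S 1\<^sub>E\<close> is rotation
  invariant although neither \<open>D\<close> nor \<open>E\<close> is.\<close>

lemma inner_S_act_indicator:
  assumes S: "SSP S" and com: "commutes_with_rotations S"
    and loc: "localized_on S D" and DE: "D \<subseteq> E"
    and E: "bounded E" "E \<in> sets lebesgue"
    and t: "t \<in> L2_space" and q: "norm q = 1"
  shows "inner_S S (\<lambda>z. t (act q z)) (indicator E) = inner_S S t (indicator E)"
proof -
  let ?ta = "\<lambda>z. t (act q z)"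
  let ?F = "{z. act q z \<in> E}"
  have EL: "indicator E \<in> L2_space" using E by (rule L2_space_indicator)
  have ta: "?ta \<in> L2_space" using q t by (rule L2_space_act)
  have FL: "(\<lambda>z. indicator E (act q z) :: real) \<in> L2_space" using q EL by (rule L2_space_act)
  have vanish: "inner_S S f g = 0"
    if f: "f \<in> L2_space" and g: "g \<in> L2_space" and 0: "\<And>z. z \<in> E \<Longrightarrow> g z = 0" for f g
  proof -
    have "ae_eq (S g) (\<lambda>z. 0)"
      using loc g 0 DE by (auto simp: localized_on_def)
    moreover have "(\<lambda>z. 0) \<in> L2_space" by (simp add: L2_space_def)
    ultimately have "inner_S S f g = L2_inner f (\<lambda>z. 0)"
      unfolding inner_S_def by (intro L2_inner_cong_AE f SSP_in_L2[OF S g])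
    then show ?thesis by (simp add: L2_inner_def)
  qed
  have "bounded ?F"
  proof -
    obtain M where "\<And>z. z \<in> E \<Longrightarrow> norm z \<le> M" using E(1) by (auto simp: bounded_iff)
    then show ?thesis using orthogonal_transformation_norm[OF orthogonal_act[OF q]]
      by (intro boundedI[of _ M]) fastforce
  qed
  moreover have "?F \<in> sets lebesgue"
  proof -
    \<comment> \<open>Lebesgue measurability of \<open>?F\<close> is read off from its indicator,
      already known to lie in \<open>L2_space\<close>.\<close>
    have "(\<lambda>z. indicator E (act q z) :: real) -` {1} \<inter> space lebesgue \<in> sets lebesgue"
      using FL by (intro measurable_sets[of _ _ borel]) (auto simp: L2_space_def)
    also have "(\<lambda>z. indicator E (act q z) :: real) -` {1} \<inter> space lebesgue = ?F"
      by (auto simp: indicator_def)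
    finally show ?thesis .
  qed
  ultimately have FE: "indicator (?F - E) \<in> L2_space" "indicator (E - ?F) \<in> L2_space"
    using E by (auto intro!: L2_space_indicator sets.Diff intro: bounded_subset)
  have inv: "act q (act (quat_cnj q) z) = z" "act (quat_cnj q) (act q z) = z" for z
    using q by (simp_all add: quat_mult_cnj_left quat_mult_cnj_right act_one flip: act_mult)
  have b: "(\<lambda>z. indicator (E - ?F) (act (quat_cnj q) z) :: real) \<in> L2_space"
    by (rule L2_space_act) (use q FE in auto)
  have "inner_S S ?ta (\<lambda>z. indicator E (act q z)) + inner_S S ?ta (indicator (E - ?F))
      = inner_S S ?ta (\<lambda>z. indicator E (act q z) + indicator (E - ?F) z)"
    by (rule inner_S_add_right[OF S ta FL FE(2), symmetric])
  also have "(\<lambda>z. indicator E (act q z) + indicator (E - ?F) z)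
      = (\<lambda>z. indicator E z + indicator (?F - E) z :: real)"
    by (auto simp: indicator_def)
  also have "inner_S S ?ta (\<lambda>z. indicator E z + indicator (?F - E) z)
      = inner_S S ?ta (indicator E) + inner_S S ?ta (indicator (?F - E))"
    by (rule inner_S_add_right[OF S ta EL FE(1)])
  also have "inner_S S ?ta (indicator (?F - E)) = 0"
    by (rule vanish[OF ta FE(1)]) simp
  finally have "inner_S S ?ta (indicator E)
      = inner_S S ?ta (\<lambda>z. indicator E (act q z)) + inner_S S ?ta (indicator (E - ?F))" by simp
  also have "inner_S S ?ta (\<lambda>z. indicator E (act q z)) = inner_S S t (indicator E)"
    by (rule inner_S_act_act[OF S com t EL q])
  also have "inner_S S ?ta (indicator (E - ?F)) = 0"
  proof -
    have "inner_S S ?ta (\<lambda>z. indicator (E - ?F) (act (quat_cnj q) (act q z)))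
        = inner_S S t (\<lambda>z. indicator (E - ?F) (act (quat_cnj q) z))"
      by (rule inner_S_act_act[OF S com t b q])
    \<comment> \<open>For \<open>z\<close> in \<open>E\<close>, the point
      \<open>act (quat_cnj q) z\<close> lies in \<open>?F\<close>, hence outside
      \<open>E - ?F\<close>.\<close>
    also have "\<dots> = 0" by (rule vanish[OF t b]) (simp add: inv)
    finally show ?thesis by (simp add: inv)
  qed
  finally show ?thesis by simp
qed

section \<open>Matches as equality in the Cauchy-Schwarz inequality\<close>

lemma translate_in_L2: "f \<in> L2_space \<Longrightarrow> translate x f \<in> L2_space"
  unfolding translate_def
  by (rule L2_space_distr) (use lborel_distr_plus[of x] in \<open>simp_all add: add.commute[of _ x]\<close>)

text \<open>Equality in the Cauchy-Schwarz inequality: \<open>F - N u\<close> has \<open>S\<close>-norm 0.\<close>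

lemma inner_S_of_equality:
  assumes S: "SSP S" and F: "F \<in> L2_space" and u: "u \<in> L2_space" and g: "g \<in> L2_space"
    and uu: "inner_S S u u = 1" and FF: "inner_S S F F = N\<^sup>2" and Fu: "inner_S S F u = N"
  shows "inner_S S F g = N * inner_S S u g"
proof -
  let ?h = "\<lambda>z. F z + (- N) * u z"
  have Nu: "(\<lambda>z. (- N) * u z) \<in> L2_space" using u by (rule L2_space_scale)
  have h: "?h \<in> L2_space" using F Nu by (rule L2_space_add)
  have h_left: "inner_S S ?h v = inner_S S F v - N * inner_S S u v" if "v \<in> L2_space" for v
    by (simp only: inner_S_add_left[OF S that F Nu] inner_S_scale_left[OF S that u])
  have "inner_S S u ?h = 0"
    unfolding SSP_inner_commute[OF S u h] h_left[OF u] by (simp add: Fu uu)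
  moreover have "inner_S S F ?h = 0"
    unfolding SSP_inner_commute[OF S F h] h_left[OF F] SSP_inner_commute[OF S u F]
    by (simp add: Fu FF power2_eq_square)
  ultimately have "inner_S S ?h ?h = 0" unfolding h_left[OF h] by simp
  then have "inner_S S ?h g = 0" by (rule inner_S_null[OF S h g])
  then show ?thesis unfolding h_left[OF g] by simp
qed

text \<open>Every rotated template is S-orthogonal to the indicator of \<open>E\<close>, so
  projecting the translate of \<open>f\<close> does not change its products with them:
  \<open>F\<close> paired with a rotated template is \<open>N\<close> times the correlation. A match
  says that this product is \<open>N\<close> at \<open>R\<close>, where both Cauchy-Schwarz factors
  are known, so \<open>F\<close> acts as \<open>N\<close> times the template rotated by
  \<open>R\<close>.\<close>

lemma correlation_eq_of_match:
  assumes S: "SSP S" and com: "commutes_with_rotations S"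
    and f: "f \<in> L2_space" and t: "t \<in> L2_space"
    and loc: "localized_on S D" "D \<subseteq> E" and E: "bounded E" "E \<in> sets lebesgue"
    and t1: "inner_S S t (indicator E) = 0" and tt: "norm_S S t = 1"
    and pos: "norm_S S (P_S S E (translate x f)) > 0"
    and R: "norm R = 1" and match: "is_match S E f t x (quat_rotation R)"
    and q: "norm q = 1"
  shows "correlation S E f t x (quat_rotation q)
    = inner_S S (\<lambda>z. t (act R z)) (\<lambda>z. t (act q z))"
proof -
  define F where "F = P_S S E (translate x f)"
  define N where "N = norm_S S F"
  define c where "c = inner_S S (translate x f) (indicator E) / inner_S S (indicator E) (indicator E)"
  have N: "N > 0" using pos by (simp add: N_def F_def)
  have xf: "translate x f \<in> L2_space" using f by (rule translate_in_L2)
  have EL: "indicator E \<in> L2_space" using E by (rule L2_space_indicator)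
  have cE: "(\<lambda>z. (- c) * indicator E z) \<in> L2_space" using EL by (rule L2_space_scale)
  have F_eq: "F = (\<lambda>z. translate x f z + (- c) * indicator E z)"
    by (simp add: F_def P_S_def c_def)
  have F: "F \<in> L2_space" unfolding F_eq using xf cE by (rule L2_space_add)
  have tq: "(\<lambda>z. t (act q z)) \<in> L2_space" if "norm q = 1" for q using that t by (rule L2_space_act)
  have Ft: "inner_S S F (\<lambda>z. t (act q z)) = N * correlation S E f t x (quat_rotation q)"
    if q: "norm q = 1" for q
  proof -
    have "inner_S S (indicator E) (\<lambda>z. t (act q z)) = 0"
      unfolding SSP_inner_commute[OF S EL tq[OF q]]
      using inner_S_act_indicator[OF S com loc E t q] t1 by simp
    then have "inner_S S F (\<lambda>z. t (act q z)) = inner_S S (translate x f) (\<lambda>z. t (act q z))"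
      unfolding F_eq by (simp only: inner_S_add_left[OF S tq[OF q] xf cE]
        inner_S_scale_left[OF S tq[OF q] EL])
    then show ?thesis
      using N by (simp add: correlation_def weight_def rotated_template_eq[OF q] N_def F_def)
  qed
  have "inner_S S t t = 1" using tt by (simp add: norm_S_def)
  then have uu: "inner_S S (\<lambda>z. t (act R z)) (\<lambda>z. t (act R z)) = 1"
    by (simp only: inner_S_act_act[OF S com t t R])
  have FF: "inner_S S F F = N\<^sup>2"
    using inner_S_nonneg[OF S F] by (simp add: N_def norm_S_def)
  have Fu: "inner_S S F (\<lambda>z. t (act R z)) = N"
    using Ft[OF R] match by (simp add: is_match_def)
  have "N * correlation S E f t x (quat_rotation q)
      = N * inner_S S (\<lambda>z. t (act R z)) (\<lambda>z. t (act q z))"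
    using inner_S_of_equality[OF S F tq[OF R] tq[OF q] uu FF Fu] Ft[OF q] by simp
  with N show ?thesis by simp
qed

theorem theorem3p1:
  fixes f t :: "real^3 \<Rightarrow> real" and x :: "real^3" and n :: nat
    and S :: "(real^3 \<Rightarrow> real) \<Rightarrow> (real^3 \<Rightarrow> real)"
    and D E :: "(real^3) set" and R :: "real^4"
  assumes "f \<in> L2_space" and "t \<in> L2_space"
    and "even n" and "n > 0"
    and "SSP S" and "commutes_with_rotations S"
    and "bounded D" and "0 \<in> interior D" and "localized_on S D"
    and "bounded E" and "E \<in> sets lebesgue" and "D \<subseteq> E"
    and "inner_S S (indicator E) (indicator E) > 0"
    and "inner_S S t (indicator E) = 0" and "norm_S S t = 1"
    and "norm_S S (P_S S E (translate x f)) > 0"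
    and "norm R = 1"
    and "is_match S E f t x (quat_rotation R)"
  shows "\<forall>Q. norm Q = 1 \<longrightarrow>
    tensor_dot n (tensor_field S E f t n x) (tensor_power n Q)
      \<le> tensor_dot n (tensor_field S E f t n x) (tensor_power n R)"
proof (intro allI impI)
  fix Q :: "real^4"
  assume Q: "norm Q = 1"
  obtain t' where t': "t' \<in> borel_measurable borel" "integrable lborel (\<lambda>z. (t' z)\<^sup>2)"
    "AE z in lborel. t z = t' z" using \<open>t \<in> L2_space\<close> by (rule L2_spaceE)
  obtain s' where s': "s' \<in> borel_measurable borel" "integrable lborel (\<lambda>z. (s' z)\<^sup>2)"
    "AE z in lborel. S t z = s' z"
    using SSP_in_L2[OF \<open>SSP S\<close> \<open>t \<in> L2_space\<close>] by (rule L2_spaceE)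
  interpret borel_representatives S t t' s' using assms t' s' by unfold_locales
  define k where "k = kern t' s' R"
  have k[measurable]: "k \<in> borel_measurable borel"
    using measurable_compose[OF measurable_Pair[OF borel_measurable_const measurable_ident]
      measurable_kern[OF t'(1) s'(1)], of R] by (simp add: k_def id_def)
  \<comment> \<open>This is where the match enters: the correlation becomes the kernel with first
    argument \<open>R\<close>, and \<open>f\<close> and \<open>x\<close> disappear.\<close>
  have corr: "correlation S E f t x (quat_rotation q) = k q" if "norm q = 1" for q
    unfolding k_def kern_eq_inner_S[OF \<open>norm R = 1\<close> that]
    by (rule correlation_eq_of_match[where D=D]) (use assms that in auto)
  obtain C where k_bound: "\<bar>k q\<bar> \<le> C" if "norm q = 1" for q
    using kern_bounded[OF t'(1,2) s'(1,2) \<open>norm R = 1\<close>] unfolding k_def by blast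
  \<comment> \<open>Integrability for each multi-index permits the exchange of the finite
    contraction with the integral.\<close>
  have int: "integrable sphere_measure (\<lambda>q. tensor_power n q i * k q)" for i
  proof (rule integrable_sphere_bounded)
    show "\<bar>tensor_power n q i * k q\<bar> \<le> 1 * C" if "norm q = 1" for q
      unfolding abs_mult by (intro mult_mono abs_tensor_power_le_1 k_bound that) auto
  qed measurable
  have "tensor_dot n (tensor_field S E f t n x) (tensor_power n q)
      = (\<integral>p. (p \<bullet> q) ^ n * kern t' s' R p \<partial>sphere_measure)" for q
  proof -
    have "tensor_field S E f t n x i = (\<integral>p. tensor_power n p i * k p \<partial>sphere_measure)" for i
      unfolding tensor_field_def
      by (intro Bochner_Integration.integral_cong refl) (simp add: corr)
    then have "tensor_dot n (tensor_field S E f t n x) (tensor_power n q)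
        = (\<Sum>i\<in>{..<n} \<rightarrow>\<^sub>E UNIV. \<integral>p. tensor_power n p i * k p * tensor_power n q i \<partial>sphere_measure)"
      by (simp add: tensor_dot_def)
    also have "\<dots> = (\<integral>p. (\<Sum>i\<in>{..<n} \<rightarrow>\<^sub>E UNIV. tensor_power n p i * k p * tensor_power n q i)
        \<partial>sphere_measure)"
      using int by (intro Bochner_Integration.integral_sum[symmetric]) auto
    also have "\<dots> = (\<integral>p. (p \<bullet> q) ^ n * k p \<partial>sphere_measure)"
      unfolding tensor_dot_tensor_power[symmetric] tensor_dot_def sum_distrib_right
      by (simp add: mult_ac)
    finally show ?thesis by (simp add: k_def)
  qed
  then show "tensor_dot n (tensor_field S E f t n x) (tensor_power n Q)
      \<le> tensor_dot n (tensor_field S E f t n x) (tensor_power n R)"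
    using kern_maximum[OF \<open>norm R = 1\<close> Q] by simp
qed

end
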